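(* There exist four pairwise disjoint triangles in $\mathbb{R}^3$, in (algebraic) general position, that have $62$ common tangent lines in $\mathbb{R}^3$.
   Context: A triangle in $\mathbb{R}^3$ is the convex hull of three distinct non-collinear points of $\mathbb{R}^3$; its three edges are the (closed) segments joining pairs of these points. A line in $\mathbb{R}^3$ is tangent to a triangle if it meets an edge of the triangle; a common tangent line of four triangles is a line tangent to each of them. The supporting line of an edge is the line containing it, regarded also as a line in $\mathbb{C}\mathbb{P}^3$. A transversal in $\mathbb{C}\mathbb{P}^3$ to four lines is a line of $\mathbb{C}\mathbb{P}^3$ meeting all four. Choosing one edge from each of four triangles gives $3^4=81$ quadruples of supporting lines. Four triangles are in (algebraic) general position if each of the 81 quadruples of supporting lines has exactly two transversals in $\mathbb{C}\mathbb{P}^3$, and all $162$ transversals so obtained are distinct. *)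

theory Defs
  imports "HOL-Analysis.Analysis"
begin

definition is_triangle :: "(real^3) set \<Rightarrow> bool" where
  "is_triangle T \<longleftrightarrow>
     (\<exists>a b c. distinct [a, b, c] \<and> \<not> collinear {a, b, c} \<and> T = convex hull {a, b, c})"

definition triangle_edges :: "(real^3) set \<Rightarrow> (real^3) set set" where
  "triangle_edges T =
     {closed_segment a b | a b c.
        distinct [a, b, c] \<and> \<not> collinear {a, b, c} \<and> T = convex hull {a, b, c}}"

text \<open>A triangle determines its vertices, so these are indeed its three edges.\<close>

lemma triangle_edges_convex_hull:
  assumes nc: "\<not> collinear {a, b, c}"
  shows "triangle_edges (convex hull {a, b, c}) =
           {closed_segment a b, closed_segment b c, closed_segment c a}"
proof -
  have ext: "{x. x extreme_point_of (convex hull {p, q, r})} = {p, q, r}"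
    if "\<not> collinear {p, q, r}" for p q r :: "real^3"
  proof -
    have "\<not> affine_dependent {p, q, r}"
      using that affine_dependent_imp_collinear_3 by blast
    then show ?thesis
      using extreme_point_of_convex_hull_affine_independent by blast
  qed
  have perm: "{p, q, r} = {a, b, c}"
    if "\<not> collinear {p, q, r}" "convex hull {a, b, c} = convex hull {p, q, r}" for p q r :: "real^3"
    using ext[OF that(1)] ext[OF nc] that(2) by simp
  have d: "a \<noteq> b" "b \<noteq> c" "a \<noteq> c"
    using nc by (metis collinear_2 insert_absorb2 insert_commute)+
  have "e \<in> {closed_segment a b, closed_segment b c, closed_segment c a}"
    if e: "e \<in> triangle_edges (convex hull {a, b, c})" for e
  proof -
    obtain p q r where pqr: "distinct [p, q, r]" "\<not> collinear {p, q, r}"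
        "convex hull {a, b, c} = convex hull {p, q, r}" and e: "e = closed_segment p q"
      using e unfolding triangle_edges_def by blast
    have "p \<in> {a, b, c}" "q \<in> {a, b, c}" "p \<noteq> q"
      using perm[OF pqr(2,3)] pqr(1) by auto
    then show ?thesis
      using e by (auto simp: closed_segment_commute)
  qed
  moreover have mem: "closed_segment p q \<in> triangle_edges (convex hull {a, b, c})"
    if "distinct [p, q, r]" "{p, q, r} = {a, b, c}" for p q r
  proof -
    have "\<not> collinear {p, q, r}" "convex hull {a, b, c} = convex hull {p, q, r}"
      using nc that(2) by simp_all
    then show ?thesis
      unfolding triangle_edges_def using that(1) by blast
  qed
  have "closed_segment a b \<in> triangle_edges (convex hull {a, b, c})"
    by (rule mem[of a b c]) (use d in auto)
  moreover have "closed_segment b c \<in> triangle_edges (convex hull {a, b, c})"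
    by (rule mem[of b c a]) (use d in auto)
  moreover have "closed_segment c a \<in> triangle_edges (convex hull {a, b, c})"
    by (rule mem[of c a b]) (use d in auto)
  ultimately show ?thesis
    by blast
qed

definition is_line :: "(real^3) set \<Rightarrow> bool" where
  "is_line l \<longleftrightarrow> affine l \<and> aff_dim l = 1"

definition tangent_to_triangle :: "(real^3) set \<Rightarrow> (real^3) set \<Rightarrow> bool" where
  "tangent_to_triangle l T \<longleftrightarrow> (\<exists>e \<in> triangle_edges T. l \<inter> e \<noteq> {})"

definition common_tangents :: "(4 \<Rightarrow> (real^3) set) \<Rightarrow> (real^3) set set" where
  "common_tangents T = {l. is_line l \<and> (\<forall>i. tangent_to_triangle l (T i))}"

text \<open>
  Complex projective 3-space is the set of one-dimensional subspaces of \<open>complex^4\<close>; its lines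
  are the two-dimensional subspaces, and two lines meet iff they share a nonzero vector.
  Affine real space is embedded by \<open>(x, y, z) \<mapsto> (x : y : z : 1)\<close>.
\<close>

definition is_cp3_line :: "(complex^4) set \<Rightarrow> bool" where
  "is_cp3_line L \<longleftrightarrow> vec.subspace L \<and> vec.dim L = 2"

definition cp3_meet :: "(complex^4) set \<Rightarrow> (complex^4) set \<Rightarrow> bool" where
  "cp3_meet L M \<longleftrightarrow> (\<exists>v. v \<noteq> 0 \<and> v \<in> L \<and> v \<in> M)"

definition homogenize :: "real^3 \<Rightarrow> complex^4" where
  "homogenize p = vector [complex_of_real (p $ 1), complex_of_real (p $ 2), complex_of_real (p $ 3), 1]"

lemma homogenize_nth:
  "homogenize p $ 1 = complex_of_real (p $ 1)" "homogenize p $ 2 = complex_of_real (p $ 2)"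
  "homogenize p $ 3 = complex_of_real (p $ 3)" "homogenize p $ 4 = 1"
  by (simp_all add: homogenize_def vector_def)

definition cp3_supporting_line :: "(real^3) set \<Rightarrow> (complex^4) set" where
  "cp3_supporting_line e = vec.span (homogenize ` (affine hull e))"

lemma cp3_supporting_line_segment:
  "cp3_supporting_line (closed_segment a b) = vec.span {homogenize a, homogenize b}"
proof -
  have hull: "affine hull (closed_segment a b) = affine hull {a, b}"
    by (simp add: segment_convex_hull affine_hull_convex_hull)
  have "homogenize (u *\<^sub>R a + v *\<^sub>R b)
          = complex_of_real u *s homogenize a + complex_of_real v *s homogenize b"
    if "u + v = 1" for u v
  proof -
    have "complex_of_real u + complex_of_real v = 1"
      using that by (metis of_real_1 of_real_add)
    then show ?thesis
      by (simp add: vec_eq_iff forall_4 homogenize_nth)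
  qed
  moreover have span: "k *s homogenize a + m *s homogenize b \<in> vec.span {homogenize a, homogenize b}" for k m
    by (rule vec.span_add; rule vec.span_scale; rule vec.span_base; simp)
  ultimately have "homogenize x \<in> vec.span {homogenize a, homogenize b}" if "x \<in> affine hull {a, b}" for x
    using that by (auto simp: affine_hull_2 intro!: span)
  then have "vec.span (homogenize ` (affine hull {a, b})) \<subseteq> vec.span {homogenize a, homogenize b}"
    by (intro vec.span_minimal) auto
  moreover have "{homogenize a, homogenize b} \<subseteq> homogenize ` (affine hull {a, b})"
    by (simp add: hull_inc)
  then have "vec.span {homogenize a, homogenize b} \<subseteq> vec.span (homogenize ` (affine hull {a, b}))"
    by (rule vec.span_mono)
  ultimately show ?thesis
    unfolding cp3_supporting_line_def hull by blast
qed

lemma is_cp3_line_supporting_line: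
  assumes "a \<noteq> b"
  shows "is_cp3_line (cp3_supporting_line (closed_segment a b))"
proof -
  have ne: "homogenize a \<noteq> homogenize b"
    using assms by (auto simp: vec_eq_iff forall_3 forall_4 homogenize_nth)
  have "homogenize a \<notin> vec.span {homogenize b}"
  proof
    assume "homogenize a \<in> vec.span {homogenize b}"
    then obtain k where k: "homogenize a = k *s homogenize b"
      by (auto simp: vec.span_singleton)
    then have "homogenize a $ 4 = k * homogenize b $ 4"
      by simp
    then have "k = 1"
      by (simp add: homogenize_nth)
    then show False
      using k ne by simp
  qed
  moreover have "homogenize b \<noteq> 0"
    by (metis homogenize_nth(4) zero_index zero_neq_one)
  ultimately have "vec.independent {homogenize a, homogenize b}"
    by (simp add: vec.independent_insert ne)
  then show ?thesis
    unfolding is_cp3_line_def cp3_supporting_line_segment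
    using ne by (simp add: vec.dim_span vec.dim_eq_card_independent)
qed

definition cp3_transversals :: "(4 \<Rightarrow> (complex^4) set) \<Rightarrow> (complex^4) set set" where
  "cp3_transversals M = {L. is_cp3_line L \<and> (\<forall>i. cp3_meet L (M i))}"

definition edge_quadruples :: "(4 \<Rightarrow> (real^3) set) \<Rightarrow> (4 \<Rightarrow> (real^3) set) set" where
  "edge_quadruples T = {e. \<forall>i. e i \<in> triangle_edges (T i)}"

definition edge_transversals :: "(4 \<Rightarrow> (real^3) set) \<Rightarrow> (complex^4) set set" where
  "edge_transversals e = cp3_transversals (\<lambda>i. cp3_supporting_line (e i))"

text \<open>
  Distinctness of the transversals within one quadruple is part of the cardinality condition;
  across different quadruples it is the disjointness condition.
\<close>

definition general_position :: "(4 \<Rightarrow> (real^3) set) \<Rightarrow> bool" where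
  "general_position T \<longleftrightarrow>
     (\<forall>e \<in> edge_quadruples T. card (edge_transversals e) = 2) \<and>
     disjoint_family_on edge_transversals (edge_quadruples T)"

end

theory Submission
  imports Defs
begin

text \<open>
  The theorem is proved by exhibiting four triangles with small integer vertices, found by computer search.
  The points \<open>a1 + t * b1\<close> of one line that lie on a transversal to it and to three further lines are
  given by the roots \<open>t\<close> of a quadratic with integer coefficients, so there are exactly two
  transversals when its discriminant does not vanish. Whether such a transversal is real and meets the
  four edges themselves is decided by the signs of linear functions at the root, that is, by the signs of
  numbers \<open>u + v * sqrt d\<close> with integers \<open>u, v, d\<close>; summing over the 81 quadruples gives 62.
  A transversal common to two quadruples would meet two edge lines of one of the triangles, hence pass
  through a vertex or lie in the plane of that triangle; a nonzero 3x3 determinant excludes either.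
\<close>

text \<open>Their 2x2 determinant is a quadratic form in \<open>p\<close>. The obstacle is that the
  roots are irrational while every decision has to be made in integers. The other three intersection
  points are therefore never computed. Whether the transversal hits an edge between its endpoints is
  read off from the sides on which the endpoints lie of a plane through the point at
  \<open>t\<close> and another edge line, and those sides are signs of affine functions of
  \<open>t\<close>. For edge 1 the condition is \<open>t > 0\<close>, because
  \<open>a1 + t * b1\<close>, rescaled, runs through the interior of that edge. Only strict signs
  are accepted: any zero makes the computation return \<open>None\<close>. A numerical result thus
  certifies the two transversals of each quadruple together with the real count. Adding the counts
  is legitimate because a real line is determined by its complexification, so disjointness of the
  complex transversal sets passes to the real ones.\<close>

section \<open>Transversals to four lines\<close>

text \<open>Laplace expansion along two pairs of rows: the pairing of the Pluecker coordinates of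
  the lines \<open>pq\<close> and \<open>rs\<close>. It vanishes exactly when two such lines
  meet.\<close>

definition det4 :: "'a::comm_ring_1^4 \<Rightarrow> 'a^4 \<Rightarrow> 'a^4 \<Rightarrow> 'a^4 \<Rightarrow> 'a" where
  "det4 p q r s =
     (p$1 * q$2 - p$2 * q$1) * (r$3 * s$4 - r$4 * s$3)
   - (p$1 * q$3 - p$3 * q$1) * (r$2 * s$4 - r$4 * s$2)
   + (p$1 * q$4 - p$4 * q$1) * (r$2 * s$3 - r$3 * s$2)
   + (p$2 * q$3 - p$3 * q$2) * (r$1 * s$4 - r$4 * s$1)
   - (p$2 * q$4 - p$4 * q$2) * (r$1 * s$3 - r$3 * s$1)
   + (p$3 * q$4 - p$4 * q$3) * (r$1 * s$2 - r$2 * s$1)"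

lemma det_eq_det4: "det A = det4 (A$1) (A$2) (A$3) (A$4 :: 'a::comm_ring_1^4)"
proof -
  have f1234: "finite {2::4, 3, 4}" "1 \<notin> {2::4, 3, 4}"
    by auto
  have f234: "finite {3::4, 4}" "2 \<notin> {3::4, 4}"
    by auto
  have f34: "finite {4::4}" "3 \<notin> {4::4}"
    by auto
  show ?thesis
    unfolding det_def UNIV_4
    unfolding sum_over_permutations_insert[OF f1234]
    unfolding sum_over_permutations_insert[OF f234]
    unfolding sum_over_permutations_insert[OF f34]
    unfolding permutes_sing
    by (simp add: sign_swap_id permutation_swap_id permutation_compose sign_compose sign_id
        swap_id_eq transpose_def det4_def algebra_simps)
qed

lemma det4_add:
  "det4 (p + p') q r s = det4 p q r s + det4 p' q r s"
  "det4 p (q + q') r s = det4 p q r s + det4 p q' r s"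
  "det4 p q (r + r') s = det4 p q r s + det4 p q r' s"
  "det4 p q r (s + s') = det4 p q r s + det4 p q r s'"
  by (simp_all add: det4_def algebra_simps)

lemma det4_scale:
  "det4 (x *s p) q r s = x * det4 p q r s"
  "det4 p (x *s q) r s = x * det4 p q r s"
  "det4 p q (x *s r) s = x * det4 p q r s"
  "det4 p q r (x *s s) = x * det4 p q r s"
  by (simp_all add: det4_def algebra_simps)

lemma det4_eq_args:
  "det4 p p r s = 0" "det4 p q p s = 0" "det4 p q r p = 0"
  "det4 p q q s = 0" "det4 p q r q = 0" "det4 p q r r = 0"
  by (simp_all add: det4_def algebra_simps)

lemma det4_zero: "det4 0 q r s = 0" "det4 p 0 r s = 0" "det4 p q 0 s = 0" "det4 p q r 0 = 0"
  by (simp_all add: det4_def)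

text \<open>Kept over an arbitrary field: over the complex numbers it makes two lines meet, over the
  reals it produces the point where a line crosses a segment.\<close>

lemma det4_eq_0_imp_dependent:
  fixes p q r s :: "'a::field^4"
  assumes "det4 p q r s = 0"
  obtains x y z w where "x *s p + y *s q + z *s r + w *s s = 0" "\<not> (x = 0 \<and> y = 0 \<and> z = 0 \<and> w = 0)"
proof -
  define A :: "'a^4^4" where "A = vector [p, q, r, s]"
  have A: "A$1 = p" "A$2 = q" "A$3 = r" "A$4 = s"
    by (simp_all add: A_def vector_def)
  have "det (transpose A) = 0"
    unfolding det_transpose by (simp add: det_eq_det4 A assms)
  then have "\<not> invertible (transpose A)"
    by (simp add: invertible_det_nz)
  then obtain v where v: "transpose A *v v = 0" "v \<noteq> 0"
    using invertible_left_inverse matrix_left_invertible_ker by blast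
  have "v$1 *s p + v$2 *s q + v$3 *s r + v$4 *s s = transpose A *v v"
    by (simp add: vec_eq_iff matrix_vector_mult_def transpose_def sum_4 A mult.commute)
  moreover have "\<not> (v$1 = 0 \<and> v$2 = 0 \<and> v$3 = 0 \<and> v$4 = 0)"
    using v(2) by (simp add: vec_eq_iff forall_4)
  ultimately show thesis
    using that v(1) by metis
qed

text \<open>Independence of the pair as a family, so that \<open>p = q\<close> counts as dependent;
  \<open>vec.independent\<close> of the set \<open>{p, q}\<close> would not see this.\<close>

definition li2 :: "'a::field^4 \<Rightarrow> 'a^4 \<Rightarrow> bool" where
  "li2 p q \<longleftrightarrow> (\<forall>x y. x *s p + y *s q = 0 \<longrightarrow> x = 0 \<and> y = 0)"

lemma li2D: "li2 p q \<Longrightarrow> x *s p + y *s q = 0 \<Longrightarrow> x = 0 \<and> y = 0"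
  by (simp add: li2_def)

lemma li2_nonzero: "li2 p q \<Longrightarrow> p \<noteq> 0" "li2 p q \<Longrightarrow> q \<noteq> 0"
  using li2D[of p q 1 0] li2D[of p q 0 1] by auto

lemma span2: "vec.span {p, q} = {x *s p + y *s q | x y. True}"
proof -
  have "v \<in> vec.span {p, q} \<longleftrightarrow> (\<exists>x y. v = x *s p + y *s q)" for v
    by (simp add: vec.span_insert vec.span_singleton) (metis add.commute diff_add_cancel add_diff_cancel)
  then show ?thesis
    by auto
qed

lemma li2_iff_independent: "li2 p q \<longleftrightarrow> p \<noteq> q \<and> vec.independent {p, q}"
proof
  assume li: "li2 p q"
  have "p \<noteq> q"
    using li2D[OF li, of 1 "-1"] by auto
  moreover have "p \<notin> vec.span {q}"
  proof
    assume "p \<in> vec.span {q}"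
    then obtain k where "p = k *s q"
      by (auto simp: vec.span_singleton)
    then show False
      using li2D[OF li, of 1 "-k"] by simp
  qed
  ultimately show "p \<noteq> q \<and> vec.independent {p, q}"
    using li2_nonzero[OF li] by (simp add: vec.independent_insert)
next
  assume ind: "p \<noteq> q \<and> vec.independent {p, q}"
  then have "q \<noteq> 0" "p \<notin> vec.span {q}"
    by (auto simp: vec.independent_insert split: if_splits)
  show "li2 p q"
    unfolding li2_def
  proof (intro allI impI)
    fix x y assume e: "x *s p + y *s q = 0"
    have "x = 0"
    proof (rule ccontr)
      assume "x \<noteq> 0"
      then have "p = (- y / x) *s q"
        using e by (simp add: vec_eq_iff field_simps eq_neg_iff_add_eq_0)
      then show False
        using \<open>p \<notin> _\<close> unfolding vec.span_singleton by blast
    qed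
    then show "x = 0 \<and> y = 0"
      using e \<open>q \<noteq> 0\<close> by simp
  qed
qed

text \<open>Two skew lines have no common point, so a point of one and a point of the other are
  always distinct and span a line.\<close>

lemma li2_if_det4_nonzero:
  assumes "det4 a b c d \<noteq> 0" and p: "p = x *s a + y *s b" "p \<noteq> 0" and q: "q = z *s c + w *s d" "q \<noteq> 0"
  shows "li2 p q"
  unfolding li2_def
proof (intro allI impI)
  fix k m assume e: "k *s p + m *s q = 0"
  \<comment> \<open>Cramer's rule: with the vanishing combination in one slot, every term but one
    repeats an argument of the determinant.\<close>
  have "k * x * det4 a b c d = det4 (k *s p + m *s q) b c d"
    "k * y * det4 a b c d = det4 a (k *s p + m *s q) c d"
    "m * z * det4 a b c d = det4 a b (k *s p + m *s q) d"
    "m * w * det4 a b c d = det4 a b c (k *s p + m *s q)"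
    by (simp_all add: p q det4_add det4_scale det4_eq_args)
  then have "k * x = 0" "k * y = 0" "m * z = 0" "m * w = 0"
    using assms(1) by (simp_all add: e det4_zero)
  then show "k = 0 \<and> m = 0"
    using p q by auto
qed

lemma cp3_line_eq_span:
  assumes "is_cp3_line L" "p \<in> L" "q \<in> L" "li2 p q"
  shows "L = vec.span {p, q}"
proof
  have "vec.independent {p, q}" "p \<noteq> q"
    using assms(4) by (auto simp: li2_iff_independent)
  then show "L \<subseteq> vec.span {p, q}"
    using assms unfolding is_cp3_line_def by (intro vec.card_ge_dim_independent) auto
  show "vec.span {p, q} \<subseteq> L"
    using assms unfolding is_cp3_line_def by (intro vec.span_minimal) auto
qed

lemma is_cp3_line_span: "li2 p q \<Longrightarrow> is_cp3_line (vec.span {p, q})"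
  unfolding is_cp3_line_def li2_iff_independent by (simp add: vec.dim_span vec.dim_eq_card_independent)

lemma cp3_line_obtain_li2:
  assumes L: "is_cp3_line L" and p: "p \<noteq> 0"
  obtains q where "q \<in> L" "li2 p q"
proof -
  have "\<not> L \<subseteq> vec.span {p}"
  proof
    assume "L \<subseteq> vec.span {p}"
    then have "vec.dim L \<le> card {p}"
      by (intro vec.dim_le_card) auto
    then show False
      using L by (simp add: is_cp3_line_def)
  qed
  then obtain q where q: "q \<in> L" "q \<notin> vec.span {p}"
    by auto
  have "q \<noteq> p"
    using q(2) vec.span_base by auto
  then have "li2 q p"
    using q(2) p by (simp add: li2_iff_independent vec.independent_insert)
  then have "li2 p q"
    by (auto simp: li2_iff_independent insert_commute)
  with q(1) show thesis
    using that by blast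
qed

text \<open>If \<open>p\<close> and \<open>q\<close> span \<open>L\<close>, a nonvanishing
  determinant would make the common nonzero vector independent of itself. If they are dependent, the
  determinant vanishes anyway, so callers need not check independence.\<close>

lemma det4_eq_0_if_meet:
  assumes L: "is_cp3_line L" "p \<in> L" "q \<in> L" and meet: "cp3_meet L (vec.span {r, s})"
  shows "det4 p q r s = 0"
proof (cases "li2 p q")
  case True
  then obtain v where v: "v \<noteq> 0" "v \<in> vec.span {p, q}" "v \<in> vec.span {r, s}"
    using meet cp3_line_eq_span[OF L] unfolding cp3_meet_def by auto
  then obtain x y z w where xy: "v = x *s p + y *s q" and zw: "v = z *s r + w *s s"
    unfolding span2 by blast
  show ?thesis
  proof (rule ccontr)
    assume "det4 p q r s \<noteq> 0"
    from li2D[OF li2_if_det4_nonzero[OF this xy v(1) zw v(1)], of 1 "-1"] show False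
      by simp
  qed
next
  case False
  then obtain x y where xy: "x *s p + y *s q = 0" "x \<noteq> 0 \<or> y \<noteq> 0"
    by (auto simp: li2_def)
  have "x * det4 p q r s = det4 (x *s p + y *s q) q r s" "y * det4 p q r s = det4 p (x *s p + y *s q) r s"
    by (simp_all add: det4_add det4_scale det4_eq_args)
  with xy show ?thesis
    by (auto simp: det4_zero)
qed

text \<open>A dependence among the four vectors, split between the two lines, names a common vector;
  it is nonzero because each pair is independent.\<close>

lemma meet_if_det4_eq_0:
  assumes "li2 p q" "li2 r s" "det4 p q r s = 0"
  shows "cp3_meet (vec.span {p, q}) (vec.span {r, s})"
proof -
  obtain x y z w where e: "x *s p + y *s q + z *s r + w *s s = 0" and nz: "\<not> (x = 0 \<and> y = 0 \<and> z = 0 \<and> w = 0)"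
    using det4_eq_0_imp_dependent[OF assms(3)] by blast
  define v where "v = x *s p + y *s q"
  have v: "v = (-z) *s r + (-w) *s s"
    using e unfolding v_def by (simp add: vec_eq_iff eq_neg_iff_add_eq_0 algebra_simps)
  have "v \<noteq> 0"
    using nz li2D[OF assms(1), of x y] li2D[OF assms(2), of "-z" "-w"] v v_def by auto
  moreover have "v \<in> vec.span {p, q}" "v \<in> vec.span {r, s}"
    unfolding span2 using v v_def by blast+
  ultimately show ?thesis
    unfolding cp3_meet_def by blast
qed

lemma det4_diff:
  "det4 (p - p') q r s = det4 p q r s - det4 p' q r s"
  "det4 p (q - q') r s = det4 p q r s - det4 p q' r s"
  by (simp_all add: det4_def algebra_simps)

text \<open>The square root of the discriminant is a parameter, so that both \<open>csqrt\<close>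
  and the real \<open>sqrt\<close> can be plugged in.\<close>

lemma quadratic_roots_iff:
  fixes a b c t s :: "'a::field_char_0"
  assumes "c \<noteq> 0" "s\<^sup>2 = b\<^sup>2 - 4 * a * c"
  shows "a + b * t + c * t\<^sup>2 = 0 \<longleftrightarrow> t = (- b + s) / (2 * c) \<or> t = (- b - s) / (2 * c)"
proof -
  have "4 * c * (a + b * t + c * t\<^sup>2) = (2 * c * t + b)\<^sup>2 - s\<^sup>2"
    using assms(2) by (simp add: power2_eq_square algebra_simps)
  also have "\<dots> = (2 * c * t - (- b + s)) * (2 * c * t - (- b - s))"
    by (simp add: power2_eq_square algebra_simps)
  finally have eq: "4 * c * (a + b * t + c * t\<^sup>2) = \<dots>" .
  have "a + b * t + c * t\<^sup>2 = 0 \<longleftrightarrow> 4 * c * (a + b * t + c * t\<^sup>2) = 0"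
    using assms(1) by simp
  also have "\<dots> \<longleftrightarrow> 2 * c * t = - b + s \<or> 2 * c * t = - b - s"
    unfolding eq mult_eq_0_iff by simp
  finally have "a + b * t + c * t\<^sup>2 = 0 \<longleftrightarrow> 2 * c * t = - b + s \<or> 2 * c * t = - b - s" .
  then show ?thesis
    using assms(1) by (simp add: eq_divide_eq mult.commute)
qed

text \<open>The kernel of the nonzero row \<open>(X, Y)\<close> is one-dimensional and contains
  \<open>(Y, - X)\<close>, which is therefore a multiple of the nonzero kernel vector
  \<open>(z, w)\<close>.\<close>

lemma kernel_2x2:
  fixes X Y z w :: "'b::field"
  assumes "z * X + w * Y = 0" "\<not> (X = 0 \<and> Y = 0)" "z \<noteq> 0 \<or> w \<noteq> 0"
  obtains k where "Y = k * z" "X = - k * w"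
proof (cases "z = 0")
  case True
  then show thesis using assms that[of "- X / w"] by auto
next
  case False
  then have X: "X = - (w * Y / z)"
    using assms(1) by (simp add: field_simps eq_neg_iff_add_eq_0)
  show thesis using assms False that[of "Y / z"] by (auto simp: X)
qed

section \<open>The quadratic of four lines and its two transversals\<close>

locale line_quadruple =
  fixes a1 b1 a2 b2 a3 b3 a4 b4 :: "complex^4"
  assumes skew: "det4 a1 b1 a2 b2 \<noteq> 0"
    and li: "li2 a3 b3" "li2 a4 b4"
begin

definition quad :: "complex^4 \<Rightarrow> complex" where
  "quad p = det4 p a2 a3 b3 * det4 p b2 a4 b4 - det4 p b2 a3 b3 * det4 p a2 a4 b4"

definition polar :: complex where
  "polar = det4 a1 a2 a3 b3 * det4 b1 b2 a4 b4 + det4 b1 a2 a3 b3 * det4 a1 b2 a4 b4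
         - det4 a1 b2 a3 b3 * det4 b1 a2 a4 b4 - det4 b1 b2 a3 b3 * det4 a1 a2 a4 b4"

definition transversal :: "(complex^4) set \<Rightarrow> bool" where
  "transversal L \<longleftrightarrow> is_cp3_line L \<and> cp3_meet L (vec.span {a1, b1}) \<and> cp3_meet L (vec.span {a2, b2}) \<and>
     cp3_meet L (vec.span {a3, b3}) \<and> cp3_meet L (vec.span {a4, b4})"

definition point :: "complex \<Rightarrow> complex^4" where
  "point t = a1 + t *s b1"

lemma quad_comb: "quad (x *s a1 + y *s b1) = quad a1 * x\<^sup>2 + polar * x * y + quad b1 * y\<^sup>2"
  by (simp add: quad_def polar_def det4_add det4_scale power2_eq_square algebra_simps)

lemma quad_point: "quad (point t) = quad a1 + polar * t + quad b1 * t\<^sup>2"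
  using quad_comb[of 1 t] by (simp add: point_def)

lemma point_nonzero: "point t \<noteq> 0"
proof
  assume "point t = 0"
  then have "det4 (point t) b1 a2 b2 = 0"
    by (simp add: det4_zero)
  then show False
    using skew by (simp add: point_def det4_add det4_scale det4_eq_args)
qed

lemma transversal_point2:
  assumes "transversal L" "p \<in> L" "p = x *s a1 + y *s b1" "p \<noteq> 0"
  obtains z w where "z \<noteq> 0 \<or> w \<noteq> 0" "z *s a2 + w *s b2 \<in> L" "L = vec.span {p, z *s a2 + w *s b2}"
    "z * det4 p a2 a3 b3 + w * det4 p b2 a3 b3 = 0" "z * det4 p a2 a4 b4 + w * det4 p b2 a4 b4 = 0"
proof -
  have L: "is_cp3_line L" and m2: "cp3_meet L (vec.span {a2, b2})"
    and m3: "cp3_meet L (vec.span {a3, b3})" and m4: "cp3_meet L (vec.span {a4, b4})"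
    using assms(1) by (auto simp: transversal_def)
  obtain u where u: "u \<noteq> 0" "u \<in> L" "u \<in> vec.span {a2, b2}"
    using m2 by (auto simp: cp3_meet_def)
  then obtain z w where zw: "u = z *s a2 + w *s b2"
    unfolding span2 by blast
  have "L = vec.span {p, u}"
    using L u(2) assms(2) li2_if_det4_nonzero[OF skew assms(3,4) zw u(1)] by (simp add: cp3_line_eq_span)
  moreover have "z \<noteq> 0 \<or> w \<noteq> 0"
    using u(1) zw by auto
  moreover have "det4 p u a3 b3 = 0" "det4 p u a4 b4 = 0"
    using det4_eq_0_if_meet[OF L assms(2) u(2)] m3 m4 by auto
  then have "z * det4 p a2 a3 b3 + w * det4 p b2 a3 b3 = 0" "z * det4 p a2 a4 b4 + w * det4 p b2 a4 b4 = 0"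
    by (simp_all add: zw det4_add det4_scale)
  ultimately show thesis
    using that u(2) zw by blast
qed

lemma quad_eq_0_if_transversal:
  assumes "transversal L" "p \<in> L" "p = x *s a1 + y *s b1"
  shows "quad p = 0"
proof (cases "p = 0")
  case True
  then show ?thesis by (simp add: quad_def det4_zero)
next
  case False
  obtain z w where zw: "z \<noteq> 0 \<or> w \<noteq> 0"
    and e3: "z * det4 p a2 a3 b3 + w * det4 p b2 a3 b3 = 0" and e4: "z * det4 p a2 a4 b4 + w * det4 p b2 a4 b4 = 0"
    using transversal_point2[OF assms False] by metis
  \<comment> \<open>A system with a nontrivial solution has determinant zero.\<close>
  have "z * quad p = 0" "w * quad p = 0"
    unfolding quad_def using e3 e4 by algebra+
  with zw show ?thesis by auto
qed

end

text \<open>By the first assumption no transversal passes through \<open>b1\<close>, the point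
  missed by the chart, and the equation in \<open>t\<close> has degree two; by the second its roots
  are distinct.\<close>

locale generic_line_quadruple = line_quadruple +
  assumes quad_b1: "quad b1 \<noteq> 0"
    and discriminant: "polar\<^sup>2 - 4 * quad a1 * quad b1 \<noteq> 0"
begin

lemma transversal_obtain_point:
  assumes "transversal L"
  obtains t where "point t \<in> L" "quad (point t) = 0"
proof -
  have sub: "vec.subspace L"
    using assms by (simp add: transversal_def is_cp3_line_def)
  obtain p where p: "p \<noteq> 0" "p \<in> L" "p \<in> vec.span {a1, b1}"
    using assms by (auto simp: transversal_def cp3_meet_def)
  then obtain x y where xy: "p = x *s a1 + y *s b1"
    unfolding span2 by blast
  have "quad p = 0"
    using quad_eq_0_if_transversal[OF assms p(2) xy] .
  have "x \<noteq> 0"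
    using \<open>quad p = 0\<close> p(1) quad_comb[of x y] quad_b1 xy by auto
  then have "point (y / x) = (1 / x) *s p"
    unfolding point_def xy by (simp add: vec_eq_iff field_simps)
  then have "point (y / x) \<in> L"
    using vec.subspace_scale[OF sub p(2)] by simp
  then show thesis
    using that quad_eq_0_if_transversal[OF assms, of "point (y / x)" 1 "y / x"] by (simp add: point_def)
qed

definition dir :: "complex \<Rightarrow> complex^4" where
  "dir t = (if det4 (point t) a2 a3 b3 = 0 \<and> det4 (point t) b2 a3 b3 = 0
            then det4 (point t) b2 a4 b4 *s a2 - det4 (point t) a2 a4 b4 *s b2
            else det4 (point t) b2 a3 b3 *s a2 - det4 (point t) a2 a3 b3 *s b2)"

text \<open>If all four coefficients vanish at \<open>t\<close>, then \<open>t\<close> is a double root of the quadratic.\<close>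

lemma coefficients_nonzero:
  "\<not> (det4 (point t) a2 a3 b3 = 0 \<and> det4 (point t) b2 a3 b3 = 0 \<and>
      det4 (point t) a2 a4 b4 = 0 \<and> det4 (point t) b2 a4 b4 = 0)"
proof
  assume a: "det4 (point t) a2 a3 b3 = 0 \<and> det4 (point t) b2 a3 b3 = 0 \<and>
      det4 (point t) a2 a4 b4 = 0 \<and> det4 (point t) b2 a4 b4 = 0"
  then have "det4 a1 a2 a3 b3 = - t * det4 b1 a2 a3 b3" "det4 a1 b2 a3 b3 = - t * det4 b1 b2 a3 b3"
    "det4 a1 a2 a4 b4 = - t * det4 b1 a2 a4 b4" "det4 a1 b2 a4 b4 = - t * det4 b1 b2 a4 b4"
    by (auto simp: point_def det4_add det4_scale eq_neg_iff_add_eq_0)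
  then have "polar\<^sup>2 - 4 * quad a1 * quad b1 = 0"
    unfolding polar_def quad_def by (simp add: power2_eq_square algebra_simps)
  with discriminant show False by contradiction
qed

lemma dir_obtain:
  obtains x y where "dir t = x *s a2 - y *s b2" "\<not> (x = 0 \<and> y = 0)"
proof (cases "det4 (point t) a2 a3 b3 = 0 \<and> det4 (point t) b2 a3 b3 = 0")
  case True
  then show thesis
    using that[of "det4 (point t) b2 a4 b4" "det4 (point t) a2 a4 b4"] coefficients_nonzero[of t]
    by (auto simp: dir_def)
next
  case False
  then show thesis
    using that[of "det4 (point t) b2 a3 b3" "det4 (point t) a2 a3 b3"] by (auto simp: dir_def)
qed

lemma dir_nonzero: "dir t \<noteq> 0"
proof
  assume d: "dir t = 0"
  obtain x y where xy: "dir t = x *s a2 + y *s b2" "\<not> (x = 0 \<and> y = 0)"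
    by (rule dir_obtain[of t]) (metis add.inverse_inverse diff_conv_add_uminus neg_equal_0_iff_equal vec.scale_minus_left)
  have "x * det4 a1 b1 a2 b2 = det4 a1 b1 (dir t) b2" "y * det4 a1 b1 a2 b2 = det4 a1 b1 a2 (dir t)"
    by (simp_all add: xy det4_add det4_scale det4_eq_args)
  then show False
    using d xy(2) skew by (simp add: det4_zero)
qed

lemma li2_point_dir: "li2 (point t) (dir t)"
proof -
  obtain x y where xy: "dir t = x *s a2 + y *s b2"
    by (rule dir_obtain[of t]) (metis add.inverse_inverse diff_conv_add_uminus vec.scale_minus_left)
  have "point t = 1 *s a1 + t *s b1"
    by (simp add: point_def)
  from li2_if_det4_nonzero[OF skew this point_nonzero xy dir_nonzero] show ?thesis .
qed

lemma transversal_eq_span: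
  assumes "transversal L" "point t \<in> L"
  shows "L = vec.span {point t, dir t}"
proof -
  have p: "point t = 1 *s a1 + t *s b1"
    by (simp add: point_def)
  have L: "is_cp3_line L" and sub: "vec.subspace L"
    using assms(1) by (auto simp: transversal_def is_cp3_line_def)
  obtain z w where zw: "z \<noteq> 0 \<or> w \<noteq> 0" and u: "z *s a2 + w *s b2 \<in> L"
    and e3: "z * det4 (point t) a2 a3 b3 + w * det4 (point t) b2 a3 b3 = 0"
    and e4: "z * det4 (point t) a2 a4 b4 + w * det4 (point t) b2 a4 b4 = 0"
    using transversal_point2[OF assms p point_nonzero] by metis
  have "\<exists>k. dir t = k *s (z *s a2 + w *s b2)"
  proof (cases "det4 (point t) a2 a3 b3 = 0 \<and> det4 (point t) b2 a3 b3 = 0")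
    case True
    then have "\<not> (det4 (point t) a2 a4 b4 = 0 \<and> det4 (point t) b2 a4 b4 = 0)"
      using coefficients_nonzero by blast
    from kernel_2x2[OF e4 this zw] obtain k
      where "det4 (point t) b2 a4 b4 = k * z" "det4 (point t) a2 a4 b4 = - k * w"
      by blast
    then have "dir t = k *s (z *s a2 + w *s b2)"
      unfolding dir_def if_P[OF True] by (simp add: vec.scale_right_distrib)
    then show ?thesis ..
  next
    case False
    from kernel_2x2[OF e3 this zw] obtain k
      where "det4 (point t) b2 a3 b3 = k * z" "det4 (point t) a2 a3 b3 = - k * w"
      by blast
    then have "dir t = k *s (z *s a2 + w *s b2)"
      unfolding dir_def if_not_P[OF False] by (simp add: vec.scale_right_distrib)
    then show ?thesis ..
  qed
  then have "dir t \<in> L"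
    using vec.subspace_scale[OF sub u] by auto
  then show ?thesis
    using cp3_line_eq_span[OF L assms(2)] li2_point_dir by blast
qed

text \<open>One equation is solved by construction of \<open>dir t\<close>; the other is either
  identically zero or follows from \<open>quad (point t) = 0\<close>.\<close>

lemma transversal_span:
  assumes q: "quad (point t) = 0"
  shows "transversal (vec.span {point t, dir t})"
proof -
  let ?L = "vec.span {point t, dir t}"
  have d: "det4 (point t) (dir t) a3 b3 = 0" "det4 (point t) (dir t) a4 b4 = 0"
    using q unfolding dir_def quad_def by (auto simp: det4_diff det4_scale)
  have "point t \<in> vec.span {a1, b1}"
    unfolding point_def by (simp add: vec.span_add vec.span_scale vec.span_base)
  moreover have "dir t \<in> vec.span {a2, b2}"
    by (rule dir_obtain[of t]) (simp add: vec.span_diff vec.span_scale vec.span_base)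
  moreover have "point t \<in> ?L" "dir t \<in> ?L"
    by (simp_all add: vec.span_base)
  ultimately have "cp3_meet ?L (vec.span {a1, b1})" "cp3_meet ?L (vec.span {a2, b2})"
    unfolding cp3_meet_def using point_nonzero dir_nonzero by blast+
  then show ?thesis
    unfolding transversal_def
    using is_cp3_line_span meet_if_det4_eq_0 li2_point_dir li d by auto
qed

lemma transversal_point_unique:
  assumes "transversal L" "point s \<in> L" "point t \<in> L"
  shows "s = t"
proof (rule ccontr)
  assume "s \<noteq> t"
  have "is_cp3_line L" "cp3_meet L (vec.span {a2, b2})"
    using assms(1) by (auto simp: transversal_def)
  then have "det4 (point s) (point t) a2 b2 = 0"
    using assms(2,3) by (intro det4_eq_0_if_meet) auto
  moreover have "det4 (point s) (point t) a2 b2 = (t - s) * det4 a1 b1 a2 b2"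
    by (simp add: point_def det4_def algebra_simps)
  ultimately show False
    using skew \<open>s \<noteq> t\<close> by simp
qed

lemma card_transversals: "card {L. transversal L} = 2"
proof -
  define s where "s = csqrt (polar\<^sup>2 - 4 * quad a1 * quad b1)"
  have s: "s\<^sup>2 = polar\<^sup>2 - 4 * quad a1 * quad b1" "s \<noteq> 0"
    using discriminant by (simp_all add: s_def)
  define R where "R = {t. quad (point t) = 0}"
  have "R = {(- polar + s) / (2 * quad b1), (- polar - s) / (2 * quad b1)}"
    unfolding R_def quad_point using quadratic_roots_iff[OF quad_b1 s(1)] by auto
  moreover have "(- polar + s) / (2 * quad b1) \<noteq> (- polar - s) / (2 * quad b1)"
    using s(2) quad_b1 by (simp add: divide_eq_eq)
  ultimately have "card R = 2"
    by simp
  have "bij_betw (\<lambda>t. vec.span {point t, dir t}) R {L. transversal L}"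
  proof (rule bij_betwI')
    fix t assume "t \<in> R"
    then show "vec.span {point t, dir t} \<in> {L. transversal L}"
      using transversal_span by (simp add: R_def)
  next
    fix L assume "L \<in> {L. transversal L}"
    then have L: "transversal L"
      by simp
    then obtain t where "point t \<in> L" "quad (point t) = 0"
      by (rule transversal_obtain_point)
    then show "\<exists>t\<in>R. L = vec.span {point t, dir t}"
      using transversal_eq_span[OF L] by (auto simp: R_def)
  next
    fix t t' assume "t \<in> R" "t' \<in> R"
    then have "transversal (vec.span {point t, dir t})"
      using transversal_span by (simp add: R_def)
    moreover have "point t \<in> vec.span {point t, dir t}" "point t' \<in> vec.span {point t', dir t'}"
      by (simp_all add: vec.span_base)
    ultimately show "vec.span {point t, dir t} = vec.span {point t', dir t'} \<longleftrightarrow> t = t'"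
      using transversal_point_unique by auto
  qed
  from bij_betw_same_card[OF this] \<open>card R = 2\<close> show ?thesis
    by simp
qed

end

section \<open>Real lines\<close>

definition rhom :: "real^3 \<Rightarrow> real^4" where
  "rhom p = vector [p$1, p$2, p$3, 1]"

lemma rhom_nth: "rhom p $ 1 = p$1" "rhom p $ 2 = p$2" "rhom p $ 3 = p$3" "rhom p $ 4 = 1"
  by (simp_all add: rhom_def vector_def)

lemma homogenize_eq_rhom: "homogenize p $ i = complex_of_real (rhom p $ i)"
  using exhaust_4[of i] by (auto simp: homogenize_nth rhom_nth)

lemma homogenize_affine:
  assumes "u + v = 1"
  shows "homogenize (u *\<^sub>R p + v *\<^sub>R q) = complex_of_real u *s homogenize p + complex_of_real v *s homogenize q"
proof -
  have "complex_of_real u + complex_of_real v = 1"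
    using assms by (metis of_real_1 of_real_add)
  then show ?thesis
    by (simp add: vec_eq_iff forall_4 homogenize_nth)
qed

lemma homogenize_nonzero: "homogenize p \<noteq> 0"
  by (metis homogenize_nth(4) zero_index zero_neq_one)

lemma det4_homogenize:
  "det4 (homogenize p) (homogenize q) (homogenize r) (homogenize s)
     = complex_of_real (det4 (rhom p) (rhom q) (rhom r) (rhom s))"
  by (simp add: det4_def homogenize_eq_rhom)

lemma li2_homogenize:
  assumes "p \<noteq> q"
  shows "li2 (homogenize p) (homogenize q)"
  unfolding li2_def
proof (intro allI impI)
  fix x y assume e: "x *s homogenize p + y *s homogenize q = 0"
  have "x + y = 0"
    using arg_cong[OF e, of "\<lambda>v. v $ 4"] by (simp add: homogenize_nth)
  then have y: "y = - x"
    by (simp add: add_eq_0_iff)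
  have "x * (homogenize p $ i - homogenize q $ i) = 0" for i
    using arg_cong[OF e, of "\<lambda>v. v $ i"] by (simp add: y algebra_simps)
  from this[of 1] this[of 2] this[of 3] assms have "x = 0"
    by (auto simp: homogenize_nth vec_eq_iff forall_3)
  then show "x = 0 \<and> y = 0"
    by (simp add: y)
qed

lemma is_line_affine_hull: "p \<noteq> q \<Longrightarrow> is_line (affine hull {p, q})"
  by (simp add: is_line_def aff_dim_2)

lemma is_line_eq_affine_hull:
  assumes "is_line l" "p \<in> l" "q \<in> l" "p \<noteq> q"
  shows "l = affine hull {p, q}"
proof -
  have "affine hull {p, q} \<subseteq> l"
    using assms by (intro hull_minimal) (auto simp: is_line_def)
  then show ?thesis
    using assms affine_dim_equal[of "affine hull {p, q}" l] by (simp add: is_line_def aff_dim_2)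
qed

lemma is_line_obtain:
  assumes "is_line l"
  obtains p q where "p \<in> l" "q \<in> l" "p \<noteq> q"
proof -
  have "l \<noteq> {}"
    using assms by (auto simp: is_line_def)
  then obtain p where p: "p \<in> l" by auto
  have "l \<noteq> {p}"
    using assms by (auto simp: is_line_def)
  then show thesis
    using p that by blast
qed

lemma cp3_supporting_line_eq_span:
  assumes "is_line l" "p \<in> l" "q \<in> l" "p \<noteq> q"
  shows "cp3_supporting_line l = vec.span {homogenize p, homogenize q}"
proof -
  have "cp3_supporting_line l = cp3_supporting_line (closed_segment p q)"
    unfolding cp3_supporting_line_def is_line_eq_affine_hull[OF assms]
    by (simp add: segment_convex_hull affine_hull_convex_hull)
  then show ?thesis
    by (simp add: cp3_supporting_line_segment)
qed

lemma is_cp3_line_supporting_real_line: "is_line l \<Longrightarrow> is_cp3_line (cp3_supporting_line l)"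
  by (metis cp3_supporting_line_eq_span is_cp3_line_span is_line_obtain li2_homogenize)

lemma homogenize_in_supporting_line: "p \<in> l \<Longrightarrow> homogenize p \<in> cp3_supporting_line l"
  unfolding cp3_supporting_line_def by (simp add: hull_inc vec.span_base)

text \<open>The coefficients of the combination may be complex, but all points are real, so the real
  parts of the coefficients work as well and still sum to 1.\<close>

lemma in_line_if_homogenize_in_supporting_line:
  assumes "is_line l" "homogenize r \<in> cp3_supporting_line l"
  shows "r \<in> l"
proof -
  obtain p q where pq: "p \<in> l" "q \<in> l" "p \<noteq> q"
    using is_line_obtain[OF assms(1)] .
  obtain x y where xy: "homogenize r = x *s homogenize p + y *s homogenize q"
    using assms(2) unfolding cp3_supporting_line_eq_span[OF assms(1) pq] span2 by blast
  have "1 = x + y"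
    using arg_cong[OF xy, of "\<lambda>v. v $ 4"] by (simp add: homogenize_nth)
  then have s: "Re x + Re y = 1"
    by (metis one_complex.sel(1) plus_complex.sel(1))
  have "r $ 1 = Re x * p $ 1 + Re y * q $ 1" "r $ 2 = Re x * p $ 2 + Re y * q $ 2"
    "r $ 3 = Re x * p $ 3 + Re y * q $ 3"
    using arg_cong[OF xy, of "\<lambda>v. Re (v $ 1)"] arg_cong[OF xy, of "\<lambda>v. Re (v $ 2)"]
      arg_cong[OF xy, of "\<lambda>v. Re (v $ 3)"] by (simp_all add: homogenize_nth)
  then have "r = Re x *\<^sub>R p + Re y *\<^sub>R q"
    by (simp add: vec_eq_iff forall_3)
  then show ?thesis
    unfolding is_line_eq_affine_hull[OF assms(1) pq] affine_hull_2 using s by blast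
qed

text \<open>A real line is the set of real points of its complexification. This lets distinctness
  and finiteness of complex transversals be used for real ones.\<close>

lemma cp3_supporting_line_inj:
  assumes "is_line l" "is_line m" "cp3_supporting_line l = cp3_supporting_line m"
  shows "l = m"
  using assms homogenize_in_supporting_line in_line_if_homogenize_in_supporting_line by blast

lemma cp3_meet_supporting_line_segment:
  assumes "l \<inter> closed_segment a b \<noteq> {}"
  shows "cp3_meet (cp3_supporting_line l) (vec.span {homogenize a, homogenize b})"
proof -
  obtain p where "p \<in> l" "p \<in> closed_segment a b"
    using assms by blast
  then have "homogenize p \<in> cp3_supporting_line l" "homogenize p \<in> vec.span {homogenize a, homogenize b}"
    using homogenize_in_supporting_line homogenize_in_supporting_line[of p "closed_segment a b"]
    by (auto simp: cp3_supporting_line_segment)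
  then show ?thesis
    unfolding cp3_meet_def using homogenize_nonzero by blast
qed

text \<open>
  The two determinants measure on which side of the plane through \<open>p\<close>, \<open>c\<close>, \<open>d\<close> the endpoints of
  the segment lie; this plane contains the line through \<open>p\<close> and \<open>q\<close>.
\<close>

lemma line_meets_segment:
  fixes p q a b c d :: "real^3"
  assumes ne: "p \<noteq> q" and copl: "det4 (rhom p) (rhom q) (rhom a) (rhom b) = 0"
    and q: "rhom q = x *s rhom c + y *s rhom d"
    and opp: "det4 (rhom p) (rhom a) (rhom c) (rhom d) * det4 (rhom p) (rhom b) (rhom c) (rhom d) < 0"
  shows "affine hull {p, q} \<inter> closed_segment a b \<noteq> {}"
proof -
  obtain k m n r where e: "k *s rhom p + m *s rhom q + n *s rhom a + r *s rhom b = 0"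
    and nz: "\<not> (k = 0 \<and> m = 0 \<and> n = 0 \<and> r = 0)"
    using det4_eq_0_imp_dependent[OF copl] by blast
  let ?X = "det4 (rhom p) (rhom a) (rhom c) (rhom d)" and ?Y = "det4 (rhom p) (rhom b) (rhom c) (rhom d)"
  \<comment> \<open>The terms of \<open>p\<close> and \<open>q\<close> drop out, the latter because
    \<open>q\<close> lies on the line \<open>cd\<close>. As \<open>?X\<close> and \<open>?Y\<close>
    have opposite signs, \<open>n\<close> and \<open>r\<close> have equal signs, and
    \<open>(n a + r b) / (n + r)\<close> is the point sought.\<close>
  have "n * ?X + r * ?Y = det4 (rhom p) (k *s rhom p + m *s rhom q + n *s rhom a + r *s rhom b) (rhom c) (rhom d)"
    by (simp add: q det4_add det4_scale det4_eq_args)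
  then have nr: "n * ?X + r * ?Y = 0"
    by (simp add: e det4_zero)
  have X: "?X \<noteq> 0" and Y: "?Y \<noteq> 0"
    using opp by auto
  have comp: "k * rhom p $ i + m * rhom q $ i + n * rhom a $ i + r * rhom b $ i = 0" for i
    using arg_cong[OF e, of "\<lambda>v. v $ i"] by simp
  have "n \<noteq> 0"
  proof
    assume "n = 0"
    then have "r = 0"
      using nr Y by simp
    have km: "m = - k"
      using comp[of 4] \<open>n = 0\<close> \<open>r = 0\<close> by (simp add: rhom_nth)
    have "k * (rhom p $ i - rhom q $ i) = 0" for i
      using comp[of i] \<open>n = 0\<close> \<open>r = 0\<close> by (simp add: km algebra_simps)
    from this[of 1] this[of 2] this[of 3] ne have "k = 0"
      by (auto simp: rhom_nth vec_eq_iff forall_3)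
    then show False
      using nz km \<open>n = 0\<close> \<open>r = 0\<close> by simp
  qed
  have "n * n * ?X * ?Y + n * r * (?Y * ?Y) = n * ?Y * (n * ?X + r * ?Y)"
    by (simp add: algebra_simps)
  then have nrY: "n * r * (?Y * ?Y) = - (n * n) * (?X * ?Y)"
    using nr by (simp add: algebra_simps)
  have "n * n > 0" "?Y * ?Y > 0"
    using \<open>n \<noteq> 0\<close> Y not_real_square_gt_zero by blast+
  then have "n * r * (?Y * ?Y) > 0"
    unfolding nrY using opp by (simp add: mult_pos_neg)
  then have nr_pos: "n * r > 0"
    using \<open>?Y * ?Y > 0\<close> zero_less_mult_pos2 by blast
  define s where "s = n + r"
  have s: "s \<noteq> 0"
    using nr_pos unfolding s_def by (auto simp: zero_less_mult_iff)
  have frac: "0 \<le> r / s" "r / s \<le> 1"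
    using nr_pos unfolding s_def by (auto simp: zero_less_mult_iff divide_simps)
  define w where "w = (n / s) *\<^sub>R a + (r / s) *\<^sub>R b"
  have n: "n / s = 1 - r / s"
    using s by (simp add: s_def field_simps)
  have "w \<in> closed_segment a b"
    unfolding w_def closed_segment_def n using frac by blast
  moreover have "- k / s + - m / s = 1"
  proof -
    have "k + m + s = 0"
      using comp[of 4] by (simp add: rhom_nth s_def)
    then have "- k - m = s"
      by simp
    then show ?thesis
      using s by (simp add: field_simps)
  qed
  moreover have "w = (- k / s) *\<^sub>R p + (- m / s) *\<^sub>R q"
  proof -
    have "n * rhom a $ i + r * rhom b $ i = - k * rhom p $ i - m * rhom q $ i" for i
      using comp[of i] by simp
    from this[of 1] this[of 2] this[of 3]
    show ?thesis
      unfolding w_def vec_eq_iff forall_3 using s by (simp add: rhom_nth field_simps)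
  qed
  ultimately have "w \<in> affine hull {p, q}"
    unfolding affine_hull_2 by blast
  with \<open>w \<in> closed_segment a b\<close> show ?thesis
    by blast
qed

section \<open>Signs at the roots of integer quadratics\<close>

text \<open>If \<open>u\<close> and \<open>v\<close> have opposite signs, the conjugate
  \<open>u - v * sqrt d\<close> has the sign of \<open>u\<close>, so the sign of the norm
  \<open>u * u - v * v * d\<close> settles the matter.\<close>

definition surd_sgn :: "int \<Rightarrow> int \<Rightarrow> int \<Rightarrow> int" where
  "surd_sgn u v d =
     (if 0 \<le> sgn u * sgn v then sgn (sgn u + sgn v) else sgn u * sgn (u * u - v * v * d))"

lemma of_int_sgn: "(of_int (sgn k) :: real) = sgn (of_int k)"
  by (simp add: sgn_if)

lemma surd_sgn_eq:
  assumes "d > 0"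
  shows "of_int (surd_sgn u v d) = sgn (of_int u + of_int v * sqrt (of_int d))"
proof (cases "0 \<le> sgn u * sgn v")
  case True
  have "sqrt (of_int d) > 0"
    using assms by simp
  consider "u > 0" "v \<ge> 0" | "u < 0" "v \<le> 0" | "u = 0" "v > 0" | "u = 0" "v < 0" | "u = 0" "v = 0"
    using True by (cases u "0::int" rule: linorder_cases; cases v "0::int" rule: linorder_cases) auto
  then show ?thesis
  proof cases
    case 1
    then have "of_int u + of_int v * sqrt (of_int d) > 0"
      using \<open>sqrt (of_int d) > 0\<close> by (intro add_pos_nonneg) auto
    with 1 show ?thesis by (simp add: surd_sgn_def sgn_if)
  next
    case 2
    then have "of_int u + of_int v * sqrt (of_int d) < 0"
      using \<open>sqrt (of_int d) > 0\<close> by (intro add_neg_nonpos) (auto simp: mult_nonpos_nonneg)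
    with 2 show ?thesis by (simp add: surd_sgn_def sgn_if)
  next
    case 3
    then have "of_int v * sqrt (of_int d) > 0"
      using \<open>sqrt (of_int d) > 0\<close> by simp
    with 3 show ?thesis by (simp add: surd_sgn_def)
  next
    case 4
    then have "of_int v * sqrt (of_int d) < 0"
      using \<open>sqrt (of_int d) > 0\<close> by (simp add: mult_neg_pos)
    with 4 show ?thesis by (simp add: surd_sgn_def)
  qed (simp add: surd_sgn_def)
next
  case False
  let ?s = "sqrt (of_int d)"
  have "?s > 0"
    using assms by simp
  have sgn: "sgn (of_int u - of_int v * ?s) = of_int (sgn u)"
  proof (cases "u > 0")
    case True
    then have "v < 0"
      using False by (auto simp: sgn_if split: if_splits)
    then have "of_int v * ?s < 0"
      using \<open>?s > 0\<close> by (simp add: mult_neg_pos)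
    then show ?thesis
      using True by (simp add: sgn_if)
  next
    case u: False
    then have uv: "u < 0" "v > 0"
      using False by (auto simp: sgn_if split: if_splits)
    then have "of_int v * ?s > 0"
      using \<open>?s > 0\<close> by simp
    then show ?thesis
      using uv by (simp add: sgn_if)
  qed
  have "(of_int u + of_int v * ?s) * (of_int u - of_int v * ?s) = of_int u * of_int u - of_int v * of_int v * (?s * ?s)"
    by (simp add: algebra_simps)
  also have "\<dots> = of_int (u * u - v * v * d)"
    using assms by simp
  finally have "sgn (of_int u + of_int v * ?s) * of_int (sgn u) = of_int (sgn (u * u - v * v * d))"
    unfolding of_int_sgn sgn[symmetric, unfolded of_int_sgn] sgn_mult[symmetric] by simp
  moreover have "sgn u * sgn u = 1"
    using False by (auto simp: sgn_if)
  then have "of_int (sgn u) * of_int (sgn u) = (1::real)"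
    by (metis of_int_1 of_int_mult)
  ultimately have "sgn (of_int u + of_int v * ?s) = of_int (sgn u) * of_int (sgn (u * u - v * v * d))"
    by (metis (no_types, opaque_lifting) mult.assoc mult.commute mult.right_neutral)
  then show ?thesis
    using False by (simp add: surd_sgn_def)
qed

fun linval :: "int \<times> int \<Rightarrow> real \<Rightarrow> real" where
  "linval (x, y) t = of_int x + of_int y * t"

text \<open>
  The value is the sign of \<open>x + y * t\<close> at the root \<open>t = (- b + k * sqrt d) / (2 * c)\<close>, up to the factor \<open>sgn c\<close>.
\<close>

fun root_sgn :: "int \<Rightarrow> int \<Rightarrow> int \<Rightarrow> int \<Rightarrow> int \<times> int \<Rightarrow> int" where
  "root_sgn b c d k (x, y) = surd_sgn (2 * c * x - b * y) (k * y) d"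

definition side_sgns :: "int \<Rightarrow> int \<Rightarrow> int \<Rightarrow> int \<Rightarrow> ((int \<times> int) \<times> (int \<times> int)) list \<Rightarrow> int list" where
  "side_sgns b c d k S = map (\<lambda>(f, g). root_sgn b c d k f * root_sgn b c d k g) S"

text \<open>\<open>s\<close> is the sign of the root and \<open>ps\<close> holds one product per
  side test, \<open>-1\<close> meaning opposite sides. A zero puts an endpoint into the testing
  plane, where strict signs decide nothing, hence \<open>None\<close>.\<close>

definition root_verdict :: "int \<Rightarrow> int list \<Rightarrow> nat option" where
  "root_verdict s ps = (if 0 \<in> set ps then None else Some (if s = 1 \<and> set ps \<subseteq> {-1} then 1 else 0))"

fun add_option :: "nat option \<Rightarrow> nat option \<Rightarrow> nat option" where
  "add_option (Some m) (Some n) = Some (m + n)"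
| "add_option _ _ = None"

lemma add_option_eq_Some: "add_option x y = Some n \<longleftrightarrow> (\<exists>k m. x = Some k \<and> y = Some m \<and> n = k + m)"
  by (cases x; cases y) auto

text \<open>The factor \<open>sgn c\<close> accounts for the denominator \<open>2 * c\<close> of the
  root; in the products of \<open>side_sgns\<close> it occurs twice and cancels.\<close>

fun root_count_disc :: "int \<Rightarrow> int \<Rightarrow> int \<Rightarrow> ((int \<times> int) \<times> (int \<times> int)) list \<Rightarrow> nat option" where
  "root_count_disc b c d S =
     (if d = 0 then None else if d < 0 then Some 0
      else add_option (root_verdict (sgn c * surd_sgn (- b) 1 d) (side_sgns b c d 1 S))
                      (root_verdict (sgn c * surd_sgn (- b) (- 1) d) (side_sgns b c d (- 1) S)))"

text \<open>\<open>a = 0\<close> is a root at 0 and \<open>c = 0\<close> a root at infinity: the two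
  ends of the first edge.\<close>

definition root_count :: "int \<Rightarrow> int \<Rightarrow> int \<Rightarrow> ((int \<times> int) \<times> (int \<times> int)) list \<Rightarrow> nat option" where
  "root_count a b c S = (if a = 0 \<or> c = 0 then None else root_count_disc b c (b * b - 4 * a * c) S)"

lemma root_sgn_eq:
  assumes "d > 0" "c \<noteq> 0" and t: "t = (- of_int b + of_int k * sqrt (of_int d)) / (2 * of_int c)"
  shows "of_int (root_sgn b c d k f) = sgn (of_int c) * sgn (linval f t)"
proof -
  obtain x y where f: "f = (x, y)"
    by (cases f)
  have "of_int c * linval f t * 2 = of_int (2 * c * x - b * y) + of_int (k * y) * sqrt (of_int d)"
    unfolding f t using assms(2) by (simp add: field_simps)
  then have "sgn (of_int (2 * c * x - b * y) + of_int (k * y) * sqrt (of_int d)) = sgn (of_int c * linval f t * 2)"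
    by simp
  then show ?thesis
    unfolding f root_sgn.simps surd_sgn_eq[OF assms(1)] by (simp add: sgn_mult)
qed

lemma root_verdict_Some:
  assumes d: "d > 0" and c: "c \<noteq> 0" and t: "t = (- of_int b + of_int k * sqrt (of_int d)) / (2 * of_int c)"
    and verdict: "root_verdict (sgn c * surd_sgn (- b) k d) (side_sgns b c d k S) = Some n"
  shows "\<forall>(f, g)\<in>set S. linval f t * linval g t \<noteq> 0"
    and "n = (if 0 < t \<and> (\<forall>(f, g)\<in>set S. linval f t * linval g t < 0) then 1 else 0)"
proof -
  have cc: "sgn (of_int c) * sgn (of_int c) = (1::real)"
    using c by (simp add: sgn_if)
  have prod: "of_int (root_sgn b c d k f * root_sgn b c d k g) = sgn (linval f t * linval g t)" for f g
  proof -
    have "of_int (root_sgn b c d k f * root_sgn b c d k g)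
        = (sgn (of_int c) * sgn (of_int c)) * sgn (linval f t * linval g t)"
      by (simp add: root_sgn_eq[OF d c t] sgn_mult mult_ac)
    then show ?thesis
      unfolding cc by simp
  qed
  have prod0: "root_sgn b c d k f * root_sgn b c d k g = 0 \<longleftrightarrow> linval f t * linval g t = 0" for f g
    using prod[of f g] by (metis of_int_0_eq_iff sgn_eq_0_iff)
  have prodm: "root_sgn b c d k f * root_sgn b c d k g = - 1 \<longleftrightarrow> linval f t * linval g t < 0" for f g
  proof -
    have "root_sgn b c d k f * root_sgn b c d k g = - 1 \<longleftrightarrow> sgn (linval f t * linval g t) = - 1"
      using prod[of f g] by (metis of_int_1 of_int_eq_iff of_int_minus)
    then show ?thesis
      by (simp add: sgn_1_neg)
  qed
  have pos: "sgn c * surd_sgn (- b) k d = 1 \<longleftrightarrow> 0 < t"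
  proof -
    \<comment> \<open>The root itself is the value of the linear function
      \<open>(0, 1)\<close>.\<close>
    have "surd_sgn (- b) k d = root_sgn b c d k (0, 1)"
      by simp
    then have "of_int (sgn c * surd_sgn (- b) k d) = sgn (of_int c) * (sgn (of_int c) * sgn (linval (0, 1) t))"
      by (simp only: of_int_mult root_sgn_eq[OF d c t] of_int_sgn)
    also have "\<dots> = sgn t"
      using cc by (simp add: mult.assoc[symmetric])
    finally have "sgn c * surd_sgn (- b) k d = 1 \<longleftrightarrow> sgn t = 1"
      by (metis of_int_1 of_int_eq_iff)
    then show ?thesis
      by (simp add: sgn_1_pos)
  qed
  have no0: "0 \<notin> set (side_sgns b c d k S)"
    and n: "n = (if sgn c * surd_sgn (- b) k d = 1 \<and> set (side_sgns b c d k S) \<subseteq> {-1} then 1 else 0)"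
    using verdict by (auto simp: root_verdict_def split: if_splits)
  show "\<forall>(f, g)\<in>set S. linval f t * linval g t \<noteq> 0"
    using no0 prod0 by (force simp: side_sgns_def)
  have "set (side_sgns b c d k S) \<subseteq> {-1} \<longleftrightarrow> (\<forall>(f, g)\<in>set S. linval f t * linval g t < 0)"
    by (auto simp: side_sgns_def prodm[symmetric])
  then show "n = (if 0 < t \<and> (\<forall>(f, g)\<in>set S. linval f t * linval g t < 0) then 1 else 0)"
    unfolding n pos by simp
qed

lemma root_count_Some:
  assumes count: "root_count a b c S = Some n"
  defines "is_root \<equiv> \<lambda>t::real. of_int a + of_int b * t + of_int c * t\<^sup>2 = 0"
  shows "a \<noteq> 0" "c \<noteq> 0" "b * b - 4 * a * c \<noteq> 0"
    and "\<And>t f g. is_root t \<Longrightarrow> (f, g) \<in> set S \<Longrightarrow> linval f t * linval g t \<noteq> 0"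
    and "card {t. 0 < t \<and> is_root t \<and> (\<forall>(f, g)\<in>set S. linval f t * linval g t < 0)} = n"
proof -
  define d where "d = b * b - 4 * a * c"
  show ac: "a \<noteq> 0" "c \<noteq> 0"
    using count by (auto simp: root_count_def split: if_splits)
  then have count': "root_count_disc b c d S = Some n"
    using count by (simp add: root_count_def d_def)
  show "b * b - 4 * a * c \<noteq> 0"
    using count' by (auto simp: d_def split: if_splits)
  then have "d \<noteq> 0"
    by (simp add: d_def)
  have "(\<forall>t f g. is_root t \<longrightarrow> (f, g) \<in> set S \<longrightarrow> linval f t * linval g t \<noteq> 0) \<and>
      card {t. 0 < t \<and> is_root t \<and> (\<forall>(f, g)\<in>set S. linval f t * linval g t < 0)} = n"
  proof (cases "d < 0")
    case True
    have "\<not> is_root t" for t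
    proof
      assume "is_root t"
      have "(2 * of_int c * t + of_int b)\<^sup>2
          = 4 * of_int c * (of_int a + of_int b * t + of_int c * t\<^sup>2) + (of_int b * of_int b - 4 * of_int a * of_int c)"
        by (simp add: power2_eq_square algebra_simps)
      also have "\<dots> = of_int d"
        using \<open>is_root t\<close> by (simp add: is_root_def d_def)
      finally show False
        using True by (metis not_less of_int_less_0_iff zero_le_power2)
    qed
    moreover have "n = 0"
      using count' True by simp
    ultimately show ?thesis
      by simp
  next
    case False
    then have d: "d > 0"
      using \<open>d \<noteq> 0\<close> by simp
    define t1 t2 :: real where "t1 = (- of_int b + of_int 1 * sqrt (of_int d)) / (2 * of_int c)"
      and "t2 = (- of_int b + of_int (-1) * sqrt (of_int d)) / (2 * of_int c)"
    obtain n1 n2 where v1: "root_verdict (sgn c * surd_sgn (- b) 1 d) (side_sgns b c d 1 S) = Some n1"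
      and v2: "root_verdict (sgn c * surd_sgn (- b) (- 1) d) (side_sgns b c d (- 1) S) = Some n2" and n: "n = n1 + n2"
      using count' d by (auto simp: add_option_eq_Some)
    note r1 = root_verdict_Some[OF d ac(2) t1_def v1] and r2 = root_verdict_Some[OF d ac(2) t2_def v2]
    have "(sqrt (of_int d))\<^sup>2 = of_int d"
      using d by simp
    also have "\<dots> = (of_int b)\<^sup>2 - 4 * of_int a * of_int c"
      by (simp add: d_def power2_eq_square)
    finally have is_root: "is_root t \<longleftrightarrow> t = t1 \<or> t = t2" for t
      unfolding is_root_def t1_def t2_def using ac(2) by (subst quadratic_roots_iff[of _ "sqrt (of_int d)"]) auto
    have "t1 \<noteq> t2"
      unfolding t1_def t2_def using d ac(2) by simp
    let ?P = "\<lambda>t. 0 < t \<and> (\<forall>(f, g)\<in>set S. linval f t * linval g t < 0)"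
    have "{t. 0 < t \<and> is_root t \<and> (\<forall>(f, g)\<in>set S. linval f t * linval g t < 0)}
        = (if ?P t1 then {t1} else {}) \<union> (if ?P t2 then {t2} else {})"
      unfolding is_root by (auto split: if_splits)
    also have "card \<dots> = n"
      unfolding n r1(2) r2(2) using \<open>t1 \<noteq> t2\<close> by simp
    finally show ?thesis
      using r1(1) r2(1) is_root by auto
  qed
  then show "\<And>t f g. is_root t \<Longrightarrow> (f, g) \<in> set S \<Longrightarrow> linval f t * linval g t \<noteq> 0"
    and "card {t. 0 < t \<and> is_root t \<and> (\<forall>(f, g)\<in>set S. linval f t * linval g t < 0)} = n"
    by auto
qed

lemma rhom_affine: "u + v = 1 \<Longrightarrow> rhom (u *\<^sub>R p + v *\<^sub>R q) = u *s rhom p + v *s rhom q"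
  by (simp add: vec_eq_iff forall_4 rhom_nth)

section \<open>Transversals to four edges with integer endpoints\<close>

type_synonym ipoint = "int \<times> int \<times> int"
type_synonym edge = "ipoint \<times> ipoint"

fun real_point :: "ipoint \<Rightarrow> real^3" where
  "real_point (x, y, z) = vector [of_int x, of_int y, of_int z]"

abbreviation hom_point :: "ipoint \<Rightarrow> complex^4" where
  "hom_point a \<equiv> homogenize (real_point a)"

fun det3 :: "ipoint \<Rightarrow> ipoint \<Rightarrow> ipoint \<Rightarrow> int" where
  "det3 (x1, y1, z1) (x2, y2, z2) (x3, y3, z3) =
     x1 * (y2 * z3 - z2 * y3) - y1 * (x2 * z3 - z2 * x3) + z1 * (x2 * y3 - y2 * x3)"

text \<open>Six times a signed tetrahedron volume: subtracting rows reduces the 4x4 determinant of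
  the homogenized points to a 3x3 one.\<close>

definition vol :: "ipoint \<Rightarrow> ipoint \<Rightarrow> ipoint \<Rightarrow> ipoint \<Rightarrow> int" where
  "vol a b c d = det3 (a - b) (a - c) (a - d)"

lemma real_point_inject: "real_point a = real_point b \<longleftrightarrow> a = b"
  by (cases a; cases b) (auto simp: vec_eq_iff forall_3)

lemma det4_rhom_real_point:
  "det4 (rhom (real_point a)) (rhom (real_point b)) (rhom (real_point c)) (rhom (real_point d)) = of_int (vol a b c d)"
  by (cases a; cases b; cases c; cases d) (simp add: det4_def rhom_nth vol_def algebra_simps)

lemma det4_hom_point:
  "det4 (hom_point a) (hom_point b) (hom_point c) (hom_point d) = of_int (vol a b c d)"
  by (simp add: det4_homogenize det4_rhom_real_point)

text \<open>A bilinear form with \<open>quad\<close> on its diagonal. Having two arguments lets one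
  formula yield the outer coefficients and, symmetrized, the middle one.\<close>

fun conic :: "edge \<Rightarrow> edge \<Rightarrow> edge \<Rightarrow> ipoint \<Rightarrow> ipoint \<Rightarrow> int" where
  "conic (a2, b2) (a3, b3) (a4, b4) p q = vol p a2 a3 b3 * vol q b2 a4 b4 - vol p b2 a3 b3 * vol q a2 a4 b4"

text \<open>Two affine functions of \<open>t\<close>: their signs tell on which side of the plane
  through the line \<open>cd\<close> and the moving point \<open>p + t * q\<close> the endpoints
  \<open>a\<close> and \<open>b\<close> lie.\<close>

fun sides :: "edge \<Rightarrow> edge \<Rightarrow> edge \<Rightarrow> (int \<times> int) \<times> (int \<times> int)" where
  "sides (p, q) (a, b) (c, d) = ((vol p a c d, vol q a c d), (vol p b c d, vol q b c d))"

fun tangent_count :: "edge \<Rightarrow> edge \<Rightarrow> edge \<Rightarrow> edge \<Rightarrow> nat option" where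
  "tangent_count (a1, b1) (a2, b2) (a3, b3) (a4, b4) =
     (if vol a1 b1 a2 b2 = 0 \<or> a3 = b3 \<or> a4 = b4 then None
      else root_count (conic (a2, b2) (a3, b3) (a4, b4) a1 a1)
             (conic (a2, b2) (a3, b3) (a4, b4) a1 b1 + conic (a2, b2) (a3, b3) (a4, b4) b1 a1)
             (conic (a2, b2) (a3, b3) (a4, b4) b1 b1)
             [sides (a1, b1) (a2, b2) (a3, b3), sides (a1, b1) (a3, b3) (a2, b2), sides (a1, b1) (a4, b4) (a2, b2)])"

fun seg :: "edge \<Rightarrow> (real^3) set" where
  "seg (a, b) = closed_segment (real_point a) (real_point b)"

definition real_transversals :: "edge \<Rightarrow> edge \<Rightarrow> edge \<Rightarrow> edge \<Rightarrow> (real^3) set set" where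
  "real_transversals e1 e2 e3 e4 =
     {l. is_line l \<and> l \<inter> seg e1 \<noteq> {} \<and> l \<inter> seg e2 \<noteq> {} \<and> l \<inter> seg e3 \<noteq> {} \<and> l \<inter> seg e4 \<noteq> {}}"

definition complex_transversals :: "edge \<Rightarrow> edge \<Rightarrow> edge \<Rightarrow> edge \<Rightarrow> (complex^4) set set" where
  "complex_transversals e1 e2 e3 e4 =
     {L. is_cp3_line L \<and> cp3_meet L (cp3_supporting_line (seg e1)) \<and> cp3_meet L (cp3_supporting_line (seg e2)) \<and>
         cp3_meet L (cp3_supporting_line (seg e3)) \<and> cp3_meet L (cp3_supporting_line (seg e4))}"

lemma supporting_line_seg: "cp3_supporting_line (seg (a, b)) = vec.span {hom_point a, hom_point b}"
  by (simp add: cp3_supporting_line_segment)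

lemma complexify_real_transversal:
  assumes "l \<in> real_transversals e1 e2 e3 e4"
  shows "cp3_supporting_line l \<in> complex_transversals e1 e2 e3 e4"
proof -
  have "cp3_meet (cp3_supporting_line l) (cp3_supporting_line (seg e))" if "l \<inter> seg e \<noteq> {}" for e
    using that cp3_meet_supporting_line_segment by (cases e) (simp add: cp3_supporting_line_segment)
  then show ?thesis
    using assms is_cp3_line_supporting_real_line
    by (auto simp: real_transversals_def complex_transversals_def)
qed

locale edge_quadruple =
  fixes a1 b1 a2 b2 a3 b3 a4 b4 :: ipoint and n :: nat
  assumes count: "tangent_count (a1, b1) (a2, b2) (a3, b3) (a4, b4) = Some n"
begin

definition A :: int where "A = conic (a2, b2) (a3, b3) (a4, b4) a1 a1"
definition B :: int where
  "B = conic (a2, b2) (a3, b3) (a4, b4) a1 b1 + conic (a2, b2) (a3, b3) (a4, b4) b1 a1"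
definition C :: int where "C = conic (a2, b2) (a3, b3) (a4, b4) b1 b1"
definition S where
  "S = [sides (a1, b1) (a2, b2) (a3, b3), sides (a1, b1) (a3, b3) (a2, b2), sides (a1, b1) (a4, b4) (a2, b2)]"

lemma vol_nonzero: "vol a1 b1 a2 b2 \<noteq> 0" and distinct: "a3 \<noteq> b3" "a4 \<noteq> b4"
  using count by (auto split: if_splits)

lemma count': "root_count A B C S = Some n"
  using count by (auto simp: A_def B_def C_def S_def split: if_splits)

lemmas root_facts = root_count_Some[OF count']

sublocale line_quadruple "hom_point a1" "hom_point b1" "hom_point a2" "hom_point b2"
  "hom_point a3" "hom_point b3" "hom_point a4" "hom_point b4"
  by unfold_locales
    (use vol_nonzero distinct in \<open>auto simp: det4_hom_point intro!: li2_homogenize simp: real_point_inject\<close>)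

lemma quad_a1: "quad (hom_point a1) = of_int A" and quad_b1_eq: "quad (hom_point b1) = of_int C"
  and polar_eq: "polar = of_int B"
  by (simp_all add: quad_def polar_def A_def B_def C_def det4_hom_point)

sublocale generic_line_quadruple "hom_point a1" "hom_point b1" "hom_point a2" "hom_point b2"
  "hom_point a3" "hom_point b3" "hom_point a4" "hom_point b4"
proof unfold_locales
  show "quad (hom_point b1) \<noteq> 0"
    using root_facts(2) by (simp add: quad_b1_eq)
  have "polar\<^sup>2 - 4 * quad (hom_point a1) * quad (hom_point b1) = of_int (B * B - 4 * A * C)"
    by (simp add: quad_a1 quad_b1_eq polar_eq power2_eq_square)
  then show "polar\<^sup>2 - 4 * quad (hom_point a1) * quad (hom_point b1) \<noteq> 0"
    using root_facts(3) by (metis of_int_eq_0_iff)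
qed

lemma complex_transversals_eq:
  "complex_transversals (a1, b1) (a2, b2) (a3, b3) (a4, b4) = {L. transversal L}"
  unfolding complex_transversals_def supporting_line_seg transversal_def ..

lemma card_complex_transversals: "card (complex_transversals (a1, b1) (a2, b2) (a3, b3) (a4, b4)) = 2"
  unfolding complex_transversals_eq by (rule card_transversals)

definition is_root :: "real \<Rightarrow> bool" where
  "is_root t \<longleftrightarrow> of_int A + of_int B * t + of_int C * t\<^sup>2 = 0"

definition G :: "real set" where
  "G = {t. 0 < t \<and> is_root t \<and> (\<forall>(f, g)\<in>set S. linval f t * linval g t < 0)}"

lemma card_G: "card G = n"
  using root_facts(5) by (simp add: G_def is_root_def)

text \<open>If \<open>L\<close> meets the edge in \<open>(1 - u) a + u b\<close>, coplanarity with
  the line \<open>cd\<close> reads \<open>(1 - u) f + u g = 0\<close>, impossible when both values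
  have the same strict sign. Only a weak inequality results, as \<open>u\<close> may be 0 or
  1.\<close>

lemma sides_nonpos:
  assumes L: "is_cp3_line L" "point (of_real t) \<in> L" and "l \<inter> seg (a, b) \<noteq> {}" "L = cp3_supporting_line l"
    and "cp3_meet L (vec.span {hom_point c, hom_point d})" and "sides (a1, b1) (a, b) (c, d) = (f, g)"
  shows "linval f t * linval g t \<le> 0"
proof -
  obtain p where p: "p \<in> l" "p \<in> closed_segment (real_point a) (real_point b)"
    using assms(3) by auto
  then obtain u where u: "0 \<le> u" "u \<le> 1" "p = (1 - u) *\<^sub>R real_point a + u *\<^sub>R real_point b"
    by (auto simp: closed_segment_def)
  have hp: "homogenize p = of_real (1 - u) *s hom_point a + of_real u *s hom_point b"
    unfolding u(3) by (rule homogenize_affine) simp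
  have "homogenize p \<in> L"
    using p(1) assms(4) homogenize_in_supporting_line by simp
  with L assms(5) have "det4 (point (of_real t)) (homogenize p) (hom_point c) (hom_point d) = 0"
    using det4_eq_0_if_meet by blast
  then have "complex_of_real ((1 - u) * linval f t + u * linval g t) = 0"
    unfolding hp point_def det4_add det4_scale det4_hom_point using assms(6) by (auto simp: algebra_simps)
  then have e: "(1 - u) * linval f t + u * linval g t = 0"
    by (simp only: of_real_eq_0_iff)
  show ?thesis
  proof (rule ccontr)
    assume "\<not> linval f t * linval g t \<le> 0"
    then consider "linval f t > 0" "linval g t > 0" | "linval f t < 0" "linval g t < 0"
      by (force simp: not_le zero_less_mult_iff)
    then show False
    proof cases
      case 1
      then have "(1 - u) * linval f t + u * linval g t > 0"
        using u by (cases "u = 0") (auto intro: add_nonneg_pos)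
      with e show False by simp
    next
      case 2
      then have "(1 - u) * linval f t + u * linval g t < 0"
        using u by (cases "u = 0") (auto intro: add_nonpos_neg simp: mult_nonneg_nonpos mult_pos_neg)
      with e show False by simp
    qed
  qed
qed

lemma real_transversal_obtain:
  assumes "l \<in> real_transversals (a1, b1) (a2, b2) (a3, b3) (a4, b4)"
  obtains t where "t \<in> G" "point (of_real t) \<in> cp3_supporting_line l"
proof -
  define L where "L = cp3_supporting_line l"
  have tr: "transversal L"
    using complexify_real_transversal[OF assms] unfolding complex_transversals_eq L_def by simp
  then have L: "is_cp3_line L" and sub: "vec.subspace L"
    by (auto simp: transversal_def is_cp3_line_def)
  obtain p where p: "p \<in> l" "p \<in> closed_segment (real_point a1) (real_point b1)"
    using assms by (auto simp: real_transversals_def)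
  then obtain u where u: "0 \<le> u" "u \<le> 1" "p = (1 - u) *\<^sub>R real_point a1 + u *\<^sub>R real_point b1"
    by (auto simp: closed_segment_def)
  have hp: "homogenize p = of_real (1 - u) *s hom_point a1 + of_real u *s hom_point b1"
    unfolding u(3) by (rule homogenize_affine) simp
  have hpL: "homogenize p \<in> L"
    unfolding L_def using p(1) by (rule homogenize_in_supporting_line)
  have "quad (homogenize p) = 0"
    using quad_eq_0_if_transversal[OF tr hpL hp] .
  then have "complex_of_real (of_int A * (1 - u)\<^sup>2 + of_int B * (1 - u) * u + of_int C * u\<^sup>2) = 0"
    unfolding hp quad_comb by (simp add: quad_a1 quad_b1_eq polar_eq)
  then have q: "of_int A * (1 - u)\<^sup>2 + of_int B * (1 - u) * u + of_int C * u\<^sup>2 = 0"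
    by (simp only: of_real_eq_0_iff)
  \<comment> \<open>At \<open>u = 0\<close> the equation would say \<open>A = 0\<close>, at
    \<open>u = 1\<close> it would say \<open>C = 0\<close>.\<close>
  have "u \<noteq> 1" "u \<noteq> 0"
    using q root_facts(1,2) by auto
  \<comment> \<open>Dividing \<open>(1 - u) a1 + u b1\<close> by \<open>1 - u\<close> moves it to
    the chart \<open>point\<close>; the open edge becomes \<open>t > 0\<close>.\<close>
  define t where "t = u / (1 - u)"
  have t: "0 < t"
    using u \<open>u \<noteq> 1\<close> \<open>u \<noteq> 0\<close> by (simp add: t_def)
  have "(1 - u)\<^sup>2 * (of_int A + of_int B * t + of_int C * t\<^sup>2)
      = of_int A * (1 - u)\<^sup>2 + of_int B * (1 - u) * u + of_int C * u\<^sup>2"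
  proof -
    have "(1 - u) * t = u"
      using \<open>u \<noteq> 1\<close> by (simp add: t_def)
    then have "of_int A * (1 - u)\<^sup>2 + of_int B * (1 - u) * u + of_int C * u\<^sup>2
        = of_int A * (1 - u)\<^sup>2 + of_int B * (1 - u) * ((1 - u) * t) + of_int C * ((1 - u) * t)\<^sup>2"
      by simp
    then show ?thesis
      by (simp add: power2_eq_square algebra_simps)
  qed
  then have root: "is_root t"
    using q \<open>u \<noteq> 1\<close> by (simp add: is_root_def)
  have "point (of_real t) = of_real (1 / (1 - u)) *s homogenize p"
    unfolding hp point_def t_def using \<open>u \<noteq> 1\<close>
    by (simp add: vec.scale_right_distrib vec.scale_scale of_real_divide[symmetric] of_real_mult[symmetric] of_real_diff[symmetric] del: of_real_divide of_real_mult of_real_diff)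
  then have ptL: "point (of_real t) \<in> L"
    using vec.subspace_scale[OF sub hpL] by simp
  have "linval f t * linval g t < 0" if fg: "(f, g) \<in> set S" for f g
  proof -
    have meets: "l \<inter> seg (a2, b2) \<noteq> {}" "l \<inter> seg (a3, b3) \<noteq> {}" "l \<inter> seg (a4, b4) \<noteq> {}"
      "cp3_meet L (vec.span {hom_point a2, hom_point b2})" "cp3_meet L (vec.span {hom_point a3, hom_point b3})"
      using assms tr by (auto simp: real_transversals_def transversal_def)
    have "linval f t * linval g t \<le> 0"
      using fg sides_nonpos[OF L ptL meets(1) L_def meets(5)] sides_nonpos[OF L ptL meets(2) L_def meets(4)]
        sides_nonpos[OF L ptL meets(3) L_def meets(4)]
      unfolding S_def by fastforce
    moreover have "linval f t * linval g t \<noteq> 0"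
      using root_facts(4)[of t f g] root fg by (simp add: is_root_def)
    ultimately show ?thesis
      by (rule order_le_neq_trans)
  qed
  then have "t \<in> G"
    using t root by (auto simp: G_def)
  then show thesis
    using that ptL L_def by simp
qed

lemma real_transversal_exists:
  assumes "t \<in> G"
  obtains l where "l \<in> real_transversals (a1, b1) (a2, b2) (a3, b3) (a4, b4)"
    "point (of_real t) \<in> cp3_supporting_line l"
proof -
  have t: "0 < t" and root: "is_root t"
    using assms by (auto simp: G_def)
  define X Y U V where "X = of_int (vol a1 a2 a3 b3) + of_int (vol b1 a2 a3 b3) * t"
    and "Y = of_int (vol a1 b2 a3 b3) + of_int (vol b1 b2 a3 b3) * t"
    and "U = of_int (vol a1 a2 a4 b4) + of_int (vol b1 a2 a4 b4) * t"
    and "V = of_int (vol a1 b2 a4 b4) + of_int (vol b1 b2 a4 b4) * t"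
  have XY: "X * Y < 0"
    using assms by (auto simp: G_def S_def X_def Y_def)
  have Q: "X * V - Y * U = 0"
    using root by (simp add: is_root_def A_def B_def C_def X_def Y_def U_def V_def power2_eq_square algebra_simps)
  have "X - Y \<noteq> 0"
    using XY by (auto simp: mult_less_0_iff)
  define p where "p = (1 / (1 + t)) *\<^sub>R real_point a1 + (t / (1 + t)) *\<^sub>R real_point b1"
  define q where "q = (- Y / (X - Y)) *\<^sub>R real_point a2 + (X / (X - Y)) *\<^sub>R real_point b2"
  have rp: "rhom p = (1 / (1 + t)) *s rhom (real_point a1) + (t / (1 + t)) *s rhom (real_point b1)"
    unfolding p_def by (rule rhom_affine) (use t in \<open>simp add: field_simps\<close>)
  have rq: "rhom q = (- Y / (X - Y)) *s rhom (real_point a2) + (X / (X - Y)) *s rhom (real_point b2)"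
    unfolding q_def by (rule rhom_affine) (use \<open>X - Y \<noteq> 0\<close> in \<open>simp add: diff_divide_distrib[symmetric]\<close>)
  have det_p: "det4 (rhom p) (rhom (real_point a)) (rhom (real_point b)) (rhom (real_point c))
      = (of_int (vol a1 a b c) + of_int (vol b1 a b c) * t) / (1 + t)" for a b c
    unfolding rp by (simp add: det4_add det4_scale det4_rhom_real_point add_divide_distrib)
  have "rhom p \<noteq> 0" "rhom q \<noteq> 0"
    by (metis rhom_nth(4) zero_index zero_neq_one)+
  then have "li2 (rhom p) (rhom q)"
    using li2_if_det4_nonzero[OF _ rp _ rq] vol_nonzero by (simp add: det4_rhom_real_point)
  then have pq: "p \<noteq> q"
    by (auto dest: li2D[of _ _ 1 "-1"])
  have pq3: "det4 (rhom p) (rhom q) (rhom (real_point a3)) (rhom (real_point b3)) = 0"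
    unfolding rq det4_add det4_scale det_p X_def[symmetric] Y_def[symmetric] by (simp add: field_simps)
  have pq4: "det4 (rhom p) (rhom q) (rhom (real_point a4)) (rhom (real_point b4)) = 0"
  proof -
    have "det4 (rhom p) (rhom q) (rhom (real_point a4)) (rhom (real_point b4)) = (X * V - Y * U) / ((X - Y) * (1 + t))"
      unfolding rq det4_add det4_scale det_p U_def[symmetric] V_def[symmetric] by (simp add: diff_divide_distrib)
    then show ?thesis
      using Q by simp
  qed
  let ?l = "affine hull {p, q}"
  have opp: "det4 (rhom p) (rhom (real_point a)) (rhom (real_point a2)) (rhom (real_point b2)) *
      det4 (rhom p) (rhom (real_point b)) (rhom (real_point a2)) (rhom (real_point b2)) < 0"
    if "sides (a1, b1) (a, b) (a2, b2) \<in> set S" for a b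
  proof -
    have "(of_int (vol a1 a a2 b2) + of_int (vol b1 a a2 b2) * t) * (of_int (vol a1 b a2 b2) + of_int (vol b1 b a2 b2) * t) < 0"
      using assms that by (auto simp: G_def)
    then show ?thesis
      unfolding det_p using t by (simp add: divide_less_0_iff)
  qed
  have "?l \<inter> seg (a3, b3) \<noteq> {}"
    using line_meets_segment[OF pq pq3 rq opp] by (simp add: S_def)
  moreover have "?l \<inter> seg (a4, b4) \<noteq> {}"
    using line_meets_segment[OF pq pq4 rq opp] by (simp add: S_def)
  moreover have "p \<in> seg (a1, b1)"
  proof -
    have "1 / (1 + t) = 1 - t / (1 + t)" "0 \<le> t / (1 + t)" "t / (1 + t) \<le> 1"
      using t by (simp_all add: field_simps)
    then show ?thesis
      unfolding p_def seg.simps closed_segment_def by auto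
  qed
  moreover have "q \<in> seg (a2, b2)"
  proof -
    have "- Y / (X - Y) = 1 - X / (X - Y)"
      using \<open>X - Y \<noteq> 0\<close> by (simp add: field_simps)
    moreover have "0 \<le> X / (X - Y)" "X / (X - Y) \<le> 1"
      using XY by (auto simp: mult_less_0_iff divide_simps)
    ultimately show ?thesis
      unfolding q_def seg.simps closed_segment_def by auto
  qed
  moreover have "p \<in> ?l" "q \<in> ?l"
    by (simp_all add: hull_inc)
  ultimately have l: "?l \<in> real_transversals (a1, b1) (a2, b2) (a3, b3) (a4, b4)"
    unfolding real_transversals_def using is_line_affine_hull[OF pq] by blast
  have "homogenize p = of_real (1 / (1 + t)) *s hom_point a1 + of_real (t / (1 + t)) *s hom_point b1"
    unfolding p_def by (rule homogenize_affine) (use t in \<open>simp add: field_simps\<close>)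
  then have "point (of_real t) = of_real (1 + t) *s homogenize p"
    unfolding point_def using t
    by (simp add: vec.scale_right_distrib vec.scale_scale of_real_mult[symmetric] del: of_real_mult of_real_divide of_real_add)
  moreover have "vec.subspace (cp3_supporting_line ?l)"
    by (simp add: cp3_supporting_line_def)
  ultimately have "point (of_real t) \<in> cp3_supporting_line ?l"
    using vec.subspace_scale homogenize_in_supporting_line[OF \<open>p \<in> ?l\<close>] by metis
  with l show thesis
    using that by blast
qed

lemma transversal_unique:
  assumes "l \<in> real_transversals (a1, b1) (a2, b2) (a3, b3) (a4, b4)" "m \<in> real_transversals (a1, b1) (a2, b2) (a3, b3) (a4, b4)"
    "point t \<in> cp3_supporting_line l" "point t \<in> cp3_supporting_line m"
  shows "l = m"
proof -
  have "transversal (cp3_supporting_line l)" "transversal (cp3_supporting_line m)"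
    using complexify_real_transversal[OF assms(1)] complexify_real_transversal[OF assms(2)]
    unfolding complex_transversals_eq by simp_all
  then have "cp3_supporting_line l = cp3_supporting_line m"
    using transversal_eq_span assms(3,4) by blast
  then show ?thesis
    using assms(1,2) cp3_supporting_line_inj by (auto simp: real_transversals_def)
qed

lemma card_real_transversals: "card (real_transversals (a1, b1) (a2, b2) (a3, b3) (a4, b4)) = n"
proof -
  let ?R = "real_transversals (a1, b1) (a2, b2) (a3, b3) (a4, b4)"
  define h where "h t = (SOME l. l \<in> ?R \<and> point (of_real t) \<in> cp3_supporting_line l)" for t :: real
  have h: "h t \<in> ?R" "point (of_real t) \<in> cp3_supporting_line (h t)" if "t \<in> G" for t
  proof -
    have "\<exists>l. l \<in> ?R \<and> point (of_real t) \<in> cp3_supporting_line l"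
      using real_transversal_exists[OF that] by blast
    then show "h t \<in> ?R" "point (of_real t) \<in> cp3_supporting_line (h t)"
      unfolding h_def by (metis (mono_tags, lifting) someI_ex)+
  qed
  have "bij_betw h G ?R"
  proof (rule bij_betw_imageI)
    show "inj_on h G"
    proof (rule inj_onI)
      fix s t assume st: "s \<in> G" "t \<in> G" "h s = h t"
      have "transversal (cp3_supporting_line (h s))"
        using complexify_real_transversal[OF h(1)[OF st(1)]] unfolding complex_transversals_eq by simp
      then have "complex_of_real s = of_real t"
        using h(2)[OF st(1)] h(2)[OF st(2), folded st(3)] by (rule transversal_point_unique)
      then show "s = t"
        by simp
    qed
    show "h ` G = ?R"
    proof
      show "h ` G \<subseteq> ?R"
        using h(1) by auto
      show "?R \<subseteq> h ` G"
      proof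
        fix l assume l: "l \<in> ?R"
        obtain t where t: "t \<in> G" "point (of_real t) \<in> cp3_supporting_line l"
          using real_transversal_obtain[OF l] .
        then have "l = h t"
          using transversal_unique[OF l h(1)] h(2) by blast
        with t(1) show "l \<in> h ` G"
          by simp
      qed
    qed
  qed
  then show ?thesis
    using bij_betw_same_card card_G by fastforce
qed

end

text \<open>Finiteness is recorded as well, since \<open>card\<close> is 0 on infinite sets and a
  count of 0 would not exclude them.\<close>

lemma card_transversals_of_edges:
  assumes "tangent_count e1 e2 e3 e4 = Some n"
  shows "card (complex_transversals e1 e2 e3 e4) = 2" "card (real_transversals e1 e2 e3 e4) = n"
    "finite (real_transversals e1 e2 e3 e4)"
proof -
  interpret edge_quadruple "fst e1" "snd e1" "fst e2" "snd e2" "fst e3" "snd e3" "fst e4" "snd e4" n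
    using assms by unfold_locales simp
  show c: "card (complex_transversals e1 e2 e3 e4) = 2"
    using card_complex_transversals by simp
  show "card (real_transversals e1 e2 e3 e4) = n"
    using card_real_transversals by simp
  have "inj_on cp3_supporting_line (real_transversals e1 e2 e3 e4)"
    by (rule inj_onI, rule cp3_supporting_line_inj) (simp_all add: real_transversals_def)
  moreover have "finite (complex_transversals e1 e2 e3 e4)"
    using c by (metis card.infinite zero_neq_numeral)
  ultimately show "finite (real_transversals e1 e2 e3 e4)"
    using complexify_real_transversal by (meson finite_imageD finite_subset image_subsetI)
qed

section \<open>Lines meeting two edges of a triangle\<close>

fun cross :: "ipoint \<Rightarrow> ipoint \<Rightarrow> ipoint" where
  "cross (x1, y1, z1) (x2, y2, z2) = (y1 * z2 - z1 * y2, z1 * x2 - x1 * z2, x1 * y2 - y1 * x2)"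

fun normal :: "ipoint \<Rightarrow> edge \<Rightarrow> ipoint" where
  "normal v (a, b) = cross (a - v) (b - v)"

text \<open>A line through \<open>v\<close> that meets an edge line lies in the plane of
  \<open>v\<close> and that edge, so its direction \<open>w\<close> is orthogonal to three normals.
  If these are independent, \<open>w = 0\<close>.\<close>

lemma line_through_vertex:
  assumes L: "is_cp3_line L" "hom_point v \<in> L"
    and meet: "cp3_meet L (cp3_supporting_line (seg e))" "cp3_meet L (cp3_supporting_line (seg f))"
      "cp3_meet L (cp3_supporting_line (seg g))"
  shows "det3 (normal v e) (normal v f) (normal v g) = 0"
proof (rule ccontr)
  assume nz: "det3 (normal v e) (normal v f) (normal v g) \<noteq> 0"
  obtain u where u: "u \<in> L" "li2 (hom_point v) u"
    using cp3_line_obtain_li2[OF L(1) homogenize_nonzero] .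
  define w where "w = u - u $ 4 *s hom_point v"
  have w4: "w $ 4 = 0"
    by (simp add: w_def homogenize_nth)
  have eq: "of_int x * w $ 1 + of_int y * w $ 2 + of_int z * w $ 3 = 0"
    if "normal v d = (x, y, z)" "cp3_meet L (cp3_supporting_line (seg d))" for d x y z
  proof -
    obtain a b where d: "d = (a, b)"
      by (cases d)
    have "det4 (hom_point v) u (hom_point a) (hom_point b) = 0"
      using that(2) det4_eq_0_if_meet[OF L u(1)] by (simp add: d cp3_supporting_line_segment)
    then have "det4 (hom_point v) w (hom_point a) (hom_point b) = 0"
      by (simp add: w_def det4_diff det4_scale det4_eq_args)
    moreover have "of_int x * w $ 1 + of_int y * w $ 2 + of_int z * w $ 3 = - det4 (hom_point v) w (hom_point a) (hom_point b)"
      using that(1)[symmetric] by (cases v; cases a; cases b) (clarsimp simp: d det4_def homogenize_nth w4, simp add: algebra_simps)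
    ultimately show ?thesis
      by simp
  qed
  obtain x1 y1 z1 x2 y2 z2 x3 y3 z3 where n: "normal v e = (x1, y1, z1)" "normal v f = (x2, y2, z2)" "normal v g = (x3, y3, z3)"
    by (metis prod_cases3)
  define D :: complex where "D = of_int (det3 (normal v e) (normal v f) (normal v g))"
  note eqs = eq[OF n(1) meet(1)] eq[OF n(2) meet(2)] eq[OF n(3) meet(3)]
  have "D * w $ 1 = 0" "D * w $ 2 = 0" "D * w $ 3 = 0"
    unfolding D_def n using eqs by (simp_all, algebra+)
  then have "w = 0"
    using nz w4 by (simp add: D_def vec_eq_iff forall_4)
  then have "u $ 4 *s hom_point v + (-1) *s u = 0"
    by (simp add: w_def)
  then show False
    using li2D[OF u(2)] by fastforce
qed

type_synonym tri = "ipoint \<times> ipoint \<times> ipoint"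

text \<open>
  A multiple of the point in which the edge line meets the plane of the triangle, in homogeneous
  coordinates with the last coordinate dropped.
\<close>

fun cut :: "tri \<Rightarrow> edge \<Rightarrow> ipoint" where
  "cut (a, b, c) ((x1, y1, z1), (x2, y2, z2)) =
     (vol a b c (x2, y2, z2) * x1 - vol a b c (x1, y1, z1) * x2,
      vol a b c (x2, y2, z2) * y1 - vol a b c (x1, y1, z1) * y2,
      vol a b c (x2, y2, z2) * z1 - vol a b c (x1, y1, z1) * z2)"

lemma det4_eq_0_if_three_on_line:
  assumes "is_cp3_line L" "p \<in> L" "q \<in> L" "r \<in> L"
  shows "det4 p q r s = 0"
proof (cases "r = 0")
  case False
  then have "cp3_meet L (vec.span {r, s})"
    unfolding cp3_meet_def using assms(4) by (meson insertI1 vec.span_base)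
  then show ?thesis
    using det4_eq_0_if_meet assms by blast
qed (simp add: det4_zero)

text \<open>A line in the plane of the triangle meets each edge line at its cut with that plane.
  Three such points on one line are dependent, and remain so after the last coordinate is
  dropped.\<close>

lemma line_in_plane:
  assumes L: "is_cp3_line L" and plane: "\<And>x. x \<in> L \<Longrightarrow> det4 (hom_point a) (hom_point b) (hom_point c) x = 0"
    and meet: "cp3_meet L (cp3_supporting_line (seg e))" "cp3_meet L (cp3_supporting_line (seg f))"
      "cp3_meet L (cp3_supporting_line (seg g))"
  shows "det3 (cut (a, b, c) e) (cut (a, b, c) f) (cut (a, b, c) g) = 0"
proof (rule ccontr)
  assume nz: "det3 (cut (a, b, c) e) (cut (a, b, c) f) (cut (a, b, c) g) \<noteq> 0"
  have "vec.subspace L"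
    using L by (simp add: is_cp3_line_def)
  have in_L: "\<exists>m\<in>L. m $ 1 = of_int x \<and> m $ 2 = of_int y \<and> m $ 3 = of_int z"
    if cut: "cut (a, b, c) d = (x, y, z)" and nz: "(x, y, z) \<noteq> 0" and meet: "cp3_meet L (cp3_supporting_line (seg d))" for d x y z
  proof -
    obtain p q where d: "d = (p, q)"
      by (cases d)
    obtain w where w: "w \<noteq> 0" "w \<in> L" "w \<in> vec.span {hom_point p, hom_point q}"
      using meet by (auto simp: d cp3_supporting_line_segment cp3_meet_def)
    then obtain k l where kl: "w = k *s hom_point p + l *s hom_point q"
      unfolding span2 by blast
    have "k \<noteq> 0 \<or> l \<noteq> 0"
      using w(1) kl by auto
    moreover have "k * of_int (vol a b c p) + l * of_int (vol a b c q) = 0"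
      using plane[OF w(2)] by (simp add: kl det4_add det4_scale det4_hom_point)
    \<comment> \<open>An edge line contained in the plane would give a zero
      \<open>cut\<close>.\<close>
    moreover have "\<not> (of_int (vol a b c p) = (0::complex) \<and> of_int (vol a b c q) = (0::complex))"
      using cut nz by (cases p; cases q) (auto simp: d zero_prod_def)
    ultimately obtain r where r: "of_int (vol a b c q) = r * k" "of_int (vol a b c p) = - r * l"
      using kernel_2x2[of k "of_int (vol a b c p)" l "of_int (vol a b c q)"] by metis
    have "r *s w = of_int (vol a b c q) *s hom_point p - of_int (vol a b c p) *s hom_point q"
      by (simp add: r kl vec.scale_right_distrib)
    moreover have "r *s w \<in> L"
      using \<open>vec.subspace L\<close> w(2) by (simp add: vec.subspace_scale)
    ultimately show ?thesis
      using cut by (cases p; cases q) (auto simp: d homogenize_nth intro!: bexI[of _ "r *s w"])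
  qed
  obtain x1 y1 z1 x2 y2 z2 x3 y3 z3 where n: "cut (a, b, c) e = (x1, y1, z1)" "cut (a, b, c) f = (x2, y2, z2)" "cut (a, b, c) g = (x3, y3, z3)"
    by (metis prod_cases3)
  have nz': "(x1, y1, z1) \<noteq> 0" "(x2, y2, z2) \<noteq> 0" "(x3, y3, z3) \<noteq> 0"
    using nz unfolding n by (auto simp: zero_prod_def)
  obtain m1 m2 m3 where m: "m1 \<in> L" "m2 \<in> L" "m3 \<in> L"
    and m1: "m1 $ 1 = of_int x1" "m1 $ 2 = of_int y1" "m1 $ 3 = of_int z1"
    and m2: "m2 $ 1 = of_int x2" "m2 $ 2 = of_int y2" "m2 $ 3 = of_int z2"
    and m3: "m3 $ 1 = of_int x3" "m3 $ 2 = of_int y3" "m3 $ 3 = of_int z3"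
    using in_L[OF n(1) nz'(1) meet(1)] in_L[OF n(2) nz'(2) meet(2)] in_L[OF n(3) nz'(3) meet(3)] by blast
  \<comment> \<open>\<open>homogenize 0\<close> is the last unit vector, so the expansion leaves the
    determinant of the first three coordinates.\<close>
  have "det4 m1 m2 m3 (homogenize 0) = of_int (det3 (x1, y1, z1) (x2, y2, z2) (x3, y3, z3))"
    by (simp add: det4_def m1 m2 m3 homogenize_nth algebra_simps)
  moreover have "det4 m1 m2 m3 (homogenize 0) = 0"
    using det4_eq_0_if_three_on_line[OF L m] .
  ultimately have "of_int (det3 (x1, y1, z1) (x2, y2, z2) (x3, y3, z3)) = (0::complex)"
    by (simp only:)
  then show False
    using nz unfolding n by (simp only: of_int_eq_0_iff)
qed

fun tri_hull :: "tri \<Rightarrow> (real^3) set" where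
  "tri_hull (a, b, c) = convex hull {real_point a, real_point b, real_point c}"

fun vertices :: "tri \<Rightarrow> ipoint list" where
  "vertices (a, b, c) = [a, b, c]"

fun edges :: "tri \<Rightarrow> edge list" where
  "edges (a, b, c) = [(a, b), (b, c), (c, a)]"

text \<open>The condition also requires the plane of the triangle to miss the origin.\<close>

fun nondegenerate :: "tri \<Rightarrow> bool" where
  "nondegenerate (a, b, c) \<longleftrightarrow> det3 a b c \<noteq> 0"

lemma vol_origin: "vol a b c (0, 0, 0) = det3 a b c"
  by (cases a; cases b; cases c) (simp add: vol_def algebra_simps)

lemma not_collinear_if_nondegenerate:
  assumes "nondegenerate (a, b, c)"
  shows "\<not> collinear {real_point a, real_point b, real_point c}"
proof
  assume "collinear {real_point a, real_point b, real_point c}"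
  then obtain u where u: "\<And>x y. x \<in> {real_point a, real_point b, real_point c} \<Longrightarrow>
      y \<in> {real_point a, real_point b, real_point c} \<Longrightarrow> \<exists>k. x - y = k *\<^sub>R u"
    unfolding collinear_def by blast
  obtain k l where kl: "real_point b - real_point a = k *\<^sub>R u" "real_point c - real_point a = l *\<^sub>R u"
    using u by (metis insertCI)
  have b: "real_point b = real_point a + k *\<^sub>R u" and c: "real_point c = real_point a + l *\<^sub>R u"
    using kl by (metis add.commute diff_add_cancel)+
  have "det4 (rhom (real_point a)) (rhom (real_point b)) (rhom (real_point c)) (rhom (real_point (0, 0, 0))) = 0"
    unfolding b c by (simp add: det4_def rhom_nth algebra_simps)
  then show False
    using assms by (simp add: det4_rhom_real_point vol_origin del: real_point.simps)
qed

lemma nondegenerate_distinct: "nondegenerate (a, b, c) \<Longrightarrow> distinct [a, b, c]"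
  by (cases a; cases b; cases c) (auto simp: algebra_simps)

lemma is_triangle_hull:
  assumes "nondegenerate t"
  shows "is_triangle (tri_hull t)"
proof -
  obtain a b c where t: "t = (a, b, c)"
    using prod_cases3 .
  have "distinct [real_point a, real_point b, real_point c]"
    using nondegenerate_distinct[OF assms[unfolded t]] by (simp add: real_point_inject)
  then show ?thesis
    unfolding is_triangle_def t tri_hull.simps
    using not_collinear_if_nondegenerate[OF assms[unfolded t]] by blast
qed

lemma triangle_edges_hull: "nondegenerate t \<Longrightarrow> triangle_edges (tri_hull t) = seg ` set (edges t)"
  by (cases t rule: prod_cases3)
    (simp add: triangle_edges_convex_hull not_collinear_if_nondegenerate del: real_point.simps nondegenerate.simps)

lemma distinct_edges:
  assumes "nondegenerate t"
  shows "distinct (edges t)"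
proof -
  obtain a b c where t: "t = (a, b, c)"
    using prod_cases3 .
  show ?thesis
    using nondegenerate_distinct[OF assms[unfolded t]] unfolding t by simp
qed

text \<open>If \<open>L\<close> meets the lines \<open>vp\<close> and \<open>vq\<close> away from
  \<open>v\<close>, it has two distinct points in the plane \<open>vpq\<close> and hence lies in it.
  In the proof \<open>l\<close> and \<open>n\<close> measure the distance of the two meeting points
  from \<open>v\<close>.\<close>

lemma line_meets_two_edges:
  assumes L: "is_cp3_line L" and meet: "cp3_meet L (vec.span {v, p})" "cp3_meet L (vec.span {v, q})"
    and x: "x \<in> L"
  shows "v \<in> L \<or> det4 v p q x = 0"
proof (rule disjCI)
  assume x': "det4 v p q x \<noteq> 0"
  have sub: "vec.subspace L"
    using L by (simp add: is_cp3_line_def)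
  obtain y where y: "y \<noteq> 0" "y \<in> L" "y \<in> vec.span {v, p}"
    using meet(1) by (auto simp: cp3_meet_def)
  obtain z where z: "z \<noteq> 0" "z \<in> L" "z \<in> vec.span {v, q}"
    using meet(2) by (auto simp: cp3_meet_def)
  obtain k l where kl: "y = k *s v + l *s p"
    using y(3) unfolding span2 by blast
  obtain m n where mn: "z = m *s v + n *s q"
    using z(3) unfolding span2 by blast
  have "l * n * det4 v p q x = det4 v y z x"
    by (simp add: kl mn det4_add det4_scale det4_eq_args)
  also have "\<dots> = 0"
  proof -
    have "det4 v y z x = - det4 y z x v"
      by (simp add: det4_def algebra_simps)
    also have "det4 y z x v = 0"
      using det4_eq_0_if_three_on_line[OF L y(2) z(2) x] .
    finally show ?thesis by simp
  qed
  finally have "l = 0 \<or> n = 0"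
    using x' by simp
  then show "v \<in> L"
  proof
    assume "l = 0"
    then have "k \<noteq> 0" "v = (1 / k) *s y"
      using kl y(1) by (auto simp: vec.scale_scale)
    then show ?thesis
      using vec.subspace_scale[OF sub y(2)] by metis
  next
    assume "n = 0"
    then have "m \<noteq> 0" "v = (1 / m) *s z"
      using mn z(1) by (auto simp: vec.scale_scale)
    then show ?thesis
      using vec.subspace_scale[OF sub z(2)] by metis
  qed
qed

fun generic_for :: "tri \<Rightarrow> edge \<Rightarrow> edge \<Rightarrow> edge \<Rightarrow> bool" where
  "generic_for t (a, b) (c, d) (p, q) \<longleftrightarrow>
     (\<forall>v\<in>set (vertices t). det3 (normal v (a, b)) (normal v (c, d)) (normal v (p, q)) \<noteq> 0) \<and>
     det3 (cut t (a, b)) (cut t (c, d)) (cut t (p, q)) \<noteq> 0"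

lemma det4_rotate:
  "det4 b c a x = det4 a b c x" "det4 c a b x = det4 a b c x"
  by (simp_all add: det4_def algebra_simps)

text \<open>Two edge lines of a triangle share a vertex, so \<open>L\<close> passes through that
  vertex or lies in the plane of the triangle; \<open>line_through_vertex\<close> and
  \<open>line_in_plane\<close> turn these cases into the two determinants of
  \<open>generic_for\<close>.\<close>

lemma two_edges_not_generic:
  assumes e: "e \<in> set (edges t)" "e' \<in> set (edges t)" "e \<noteq> e'"
    and L: "is_cp3_line L" and meet: "cp3_meet L (cp3_supporting_line (seg e))" "cp3_meet L (cp3_supporting_line (seg e'))"
      "cp3_meet L (cp3_supporting_line (seg f))" "cp3_meet L (cp3_supporting_line (seg g))"
      "cp3_meet L (cp3_supporting_line (seg h))"
    and gen: "generic_for t f g h"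
  shows False
proof -
  obtain a b c where abc: "t = (a, b, c)"
    using prod_cases3 .
  have gen': "\<And>v. v \<in> {a, b, c} \<Longrightarrow> det3 (normal v f) (normal v g) (normal v h) \<noteq> 0"
    "det3 (cut (a, b, c) f) (cut (a, b, c) g) (cut (a, b, c) h) \<noteq> 0"
    using gen by (cases f; cases g; cases h; auto simp: abc)+
  have plane: "(\<exists>v\<in>{a, b, c}. hom_point v \<in> L) \<or> (\<forall>x\<in>L. det4 (hom_point a) (hom_point b) (hom_point c) x = 0)"
    if "cp3_meet L (vec.span {hom_point v, hom_point p})" "cp3_meet L (vec.span {hom_point q, hom_point v})"
      "(v, p, q) \<in> {(a, b, c), (b, c, a), (c, a, b)}" for v p q
  proof -
    have rot: "det4 (hom_point v) (hom_point p) (hom_point q) x = det4 (hom_point a) (hom_point b) (hom_point c) x" for x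
      using that(3) by (auto simp: det4_rotate)
    have "hom_point v \<in> L \<or> det4 (hom_point v) (hom_point p) (hom_point q) x = 0" if "x \<in> L" for x
      using line_meets_two_edges[OF L, of "hom_point v" "hom_point p" "hom_point q" x] that
        \<open>cp3_meet L (vec.span {hom_point v, hom_point p})\<close> \<open>cp3_meet L (vec.span {hom_point q, hom_point v})\<close>
      unfolding rot by (simp add: insert_commute)
    then show ?thesis
      using that(3) unfolding rot by auto
  qed
  have "(\<exists>v\<in>{a, b, c}. hom_point v \<in> L) \<or> (\<forall>x\<in>L. det4 (hom_point a) (hom_point b) (hom_point c) x = 0)"
  proof -
    \<comment> \<open>Up to order, two distinct edges follow each other cyclically; the shared
      vertex is \<open>b\<close>, \<open>c\<close> or \<open>a\<close> respectively.\<close>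
    consider "cp3_meet L (cp3_supporting_line (seg (a, b)))" "cp3_meet L (cp3_supporting_line (seg (b, c)))"
      | "cp3_meet L (cp3_supporting_line (seg (b, c)))" "cp3_meet L (cp3_supporting_line (seg (c, a)))"
      | "cp3_meet L (cp3_supporting_line (seg (c, a)))" "cp3_meet L (cp3_supporting_line (seg (a, b)))"
      using e meet(1,2) unfolding abc edges.simps by fastforce
    then show ?thesis
      unfolding supporting_line_seg using plane[of b c a] plane[of c a b] plane[of a b c] by cases simp_all
  qed
  then show False
    using line_through_vertex[OF L _ meet(3-5)] line_in_plane[OF L _ meet(3-5)] gen' by blast
qed

section \<open>Quadruples of triangles\<close>

fun dot :: "ipoint \<Rightarrow> ipoint \<Rightarrow> int" where
  "dot (x1, y1, z1) (x2, y2, z2) = x1 * x2 + y1 * y2 + z1 * z2"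

definition separated :: "ipoint \<Rightarrow> int \<Rightarrow> tri \<Rightarrow> tri \<Rightarrow> bool" where
  "separated n c s t \<longleftrightarrow> (\<forall>v\<in>set (vertices s). dot n v < c) \<and> (\<forall>v\<in>set (vertices t). c \<le> dot n v)"

lemma inner_real_point: "real_point n \<bullet> real_point v = of_int (dot n v)"
  by (cases n; cases v) (simp add: inner_vec_def sum_3)

lemma tri_hull_subset:
  assumes "convex H" "\<And>v. v \<in> set (vertices t) \<Longrightarrow> real_point v \<in> H"
  shows "tri_hull t \<subseteq> H"
proof (cases t rule: prod_cases3)
  case (fields a b c)
  show ?thesis
    unfolding fields tri_hull.simps using assms by (intro hull_minimal) (auto simp: fields)
qed

lemma disjoint_if_separated:
  assumes "separated n c s t"
  shows "tri_hull s \<inter> tri_hull t = {}"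
proof -
  have "tri_hull s \<subseteq> {x. real_point n \<bullet> x < of_int c}"
    using assms by (intro tri_hull_subset convex_halfspace_lt) (auto simp: separated_def inner_real_point)
  moreover have "tri_hull t \<subseteq> {x. real_point n \<bullet> x \<ge> of_int c}"
    using assms by (intro tri_hull_subset convex_halfspace_ge) (auto simp: separated_def inner_real_point)
  ultimately show ?thesis
    by fastforce
qed

definition generic_triangle :: "tri \<Rightarrow> tri \<Rightarrow> tri \<Rightarrow> tri \<Rightarrow> bool" where
  "generic_triangle t t' t'' t''' \<longleftrightarrow>
     (\<forall>e\<in>set (edges t'). \<forall>f\<in>set (edges t''). \<forall>g\<in>set (edges t'''). generic_for t e f g)"

definition sum_option :: "nat option list \<Rightarrow> nat option" where
  "sum_option xs = foldr add_option xs (Some 0)"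

lemma sum_option_Some:
  "sum_option (map f xs) = Some n \<Longrightarrow> (\<forall>x\<in>set xs. f x \<noteq> None) \<and> n = (\<Sum>x\<leftarrow>xs. the (f x))"
  by (induction xs arbitrary: n) (auto simp: sum_option_def add_option_eq_Some)

definition edge_tuples :: "tri \<Rightarrow> tri \<Rightarrow> tri \<Rightarrow> tri \<Rightarrow> (edge \<times> edge \<times> edge \<times> edge) list" where
  "edge_tuples s t u v = List.product (edges s) (List.product (edges t) (List.product (edges u) (edges v)))"

text \<open>One \<open>None\<close> spoils the sum, so a value \<open>Some N\<close> certifies all
  81 quadruples in addition to the total.\<close>

definition total_count :: "tri \<Rightarrow> tri \<Rightarrow> tri \<Rightarrow> tri \<Rightarrow> nat option" where
  "total_count s t u v =
     sum_option (map (\<lambda>(e1, e2, e3, e4). tangent_count e1 e2 e3 e4) (edge_tuples s t u v))"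

locale four_triangles =
  fixes t1 t2 t3 t4 :: tri and N :: nat
  assumes nondegenerate: "nondegenerate t1" "nondegenerate t2" "nondegenerate t3" "nondegenerate t4"
    and disjoint: "tri_hull t1 \<inter> tri_hull t2 = {}" "tri_hull t1 \<inter> tri_hull t3 = {}" "tri_hull t1 \<inter> tri_hull t4 = {}"
      "tri_hull t2 \<inter> tri_hull t3 = {}" "tri_hull t2 \<inter> tri_hull t4 = {}" "tri_hull t3 \<inter> tri_hull t4 = {}"
    and generic: "generic_triangle t1 t2 t3 t4" "generic_triangle t2 t1 t3 t4" "generic_triangle t3 t1 t2 t4"
      "generic_triangle t4 t1 t2 t3"
    and total: "total_count t1 t2 t3 t4 = Some N"
begin

definition T :: "4 \<Rightarrow> (real^3) set" where
  "T i = tri_hull (if i = 1 then t1 else if i = 2 then t2 else if i = 3 then t3 else t4)"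

lemma T_simps: "T 1 = tri_hull t1" "T 2 = tri_hull t2" "T 3 = tri_hull t3" "T 4 = tri_hull t4"
  by (simp_all add: T_def)

definition Q where "Q = set (edge_tuples t1 t2 t3 t4)"

definition cplx where "cplx = (\<lambda>(e1, e2, e3, e4). complex_transversals e1 e2 e3 e4)"
definition reals where "reals = (\<lambda>(e1, e2, e3, e4). real_transversals e1 e2 e3 e4)"
definition cnt where "cnt = (\<lambda>(e1, e2, e3, e4). tangent_count e1 e2 e3 e4)"

lemma Q_eq: "Q = set (edges t1) \<times> set (edges t2) \<times> set (edges t3) \<times> set (edges t4)"
  by (simp add: Q_def edge_tuples_def)

lemma distinct_edge_tuples: "distinct (edge_tuples t1 t2 t3 t4)"
  unfolding edge_tuples_def by (intro distinct_product distinct_edges nondegenerate)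

lemma cnt_Some: "x \<in> Q \<Longrightarrow> cnt x \<noteq> None" and N_eq: "N = (\<Sum>x\<in>Q. the (cnt x))"
proof -
  have *: "(\<forall>x\<in>set (edge_tuples t1 t2 t3 t4). cnt x \<noteq> None) \<and> N = (\<Sum>x\<leftarrow>edge_tuples t1 t2 t3 t4. the (cnt x))"
    using sum_option_Some total unfolding total_count_def cnt_def by blast
  then show "x \<in> Q \<Longrightarrow> cnt x \<noteq> None"
    by (auto simp: Q_def)
  show "N = (\<Sum>x\<in>Q. the (cnt x))"
    using * distinct_edge_tuples by (simp add: Q_def sum_list_distinct_conv_sum_set)
qed

lemma card_facts:
  assumes "x \<in> Q"
  shows "card (cplx x) = 2" "card (reals x) = the (cnt x)" "finite (reals x)"
proof -
  obtain e1 e2 e3 e4 where x: "x = (e1, e2, e3, e4)"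
    using prod_cases4 .
  obtain n where "tangent_count e1 e2 e3 e4 = Some n"
    using cnt_Some[OF assms] by (auto simp: x cnt_def)
  then show "card (cplx x) = 2" "card (reals x) = the (cnt x)" "finite (reals x)"
    using card_transversals_of_edges by (simp_all add: x cplx_def reals_def cnt_def)
qed

text \<open>Where the quadruples differ, a common transversal meets two edge lines of one triangle
  as well as an edge line of each of the other three.\<close>

lemma cplx_disjoint:
  assumes "x \<in> Q" "y \<in> Q" "x \<noteq> y"
  shows "cplx x \<inter> cplx y = {}"
proof (rule ccontr)
  assume "cplx x \<inter> cplx y \<noteq> {}"
  then obtain L where L: "L \<in> cplx x" "L \<in> cplx y"
    by blast
  obtain e1 e2 e3 e4 where x: "x = (e1, e2, e3, e4)"
    using prod_cases4 .
  obtain f1 f2 f3 f4 where y: "y = (f1, f2, f3, f4)"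
    using prod_cases4 .
  have e: "e1 \<in> set (edges t1)" "e2 \<in> set (edges t2)" "e3 \<in> set (edges t3)" "e4 \<in> set (edges t4)"
    and f: "f1 \<in> set (edges t1)" "f2 \<in> set (edges t2)" "f3 \<in> set (edges t3)" "f4 \<in> set (edges t4)"
    using assms by (simp_all add: Q_eq x y)
  have line: "is_cp3_line L"
    and me: "cp3_meet L (cp3_supporting_line (seg e1))" "cp3_meet L (cp3_supporting_line (seg e2))"
      "cp3_meet L (cp3_supporting_line (seg e3))" "cp3_meet L (cp3_supporting_line (seg e4))"
    and mf: "cp3_meet L (cp3_supporting_line (seg f1))" "cp3_meet L (cp3_supporting_line (seg f2))"
      "cp3_meet L (cp3_supporting_line (seg f3))" "cp3_meet L (cp3_supporting_line (seg f4))"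
    using L by (simp_all add: x y cplx_def complex_transversals_def)
  have g: "generic_for t1 e2 e3 e4" "generic_for t2 e1 e3 e4" "generic_for t3 e1 e2 e4" "generic_for t4 e1 e2 e3"
    using generic e by (simp_all add: generic_triangle_def)
  have "e1 = f1" "e2 = f2" "e3 = f3" "e4 = f4"
    using two_edges_not_generic[OF e(1) f(1) _ line me(1) mf(1) me(2,3,4) g(1)]
      two_edges_not_generic[OF e(2) f(2) _ line me(2) mf(2) me(1,3,4) g(2)]
      two_edges_not_generic[OF e(3) f(3) _ line me(3) mf(3) me(1,2,4) g(3)]
      two_edges_not_generic[OF e(4) f(4) _ line me(4) mf(4) me(1,2,3) g(4)] by blast+
  then show False
    using assms(3) x y by simp
qed

lemma edge_quadruple_obtain:
  assumes "e \<in> edge_quadruples T"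
  obtains e1 e2 e3 e4 where "(e1, e2, e3, e4) \<in> Q" "e 1 = seg e1" "e 2 = seg e2" "e 3 = seg e3" "e 4 = seg e4"
    "edge_transversals e = cplx (e1, e2, e3, e4)"
proof -
  have "e 1 \<in> seg ` set (edges t1)" "e 2 \<in> seg ` set (edges t2)" "e 3 \<in> seg ` set (edges t3)" "e 4 \<in> seg ` set (edges t4)"
    using assms unfolding edge_quadruples_def
    by (simp_all add: forall_4 T_simps triangle_edges_hull nondegenerate)
  then obtain e1 e2 e3 e4 where i: "e1 \<in> set (edges t1)" "e2 \<in> set (edges t2)" "e3 \<in> set (edges t3)" "e4 \<in> set (edges t4)"
    and e: "e 1 = seg e1" "e 2 = seg e2" "e 3 = seg e3" "e 4 = seg e4"
    by blast
  have "edge_transversals e = cplx (e1, e2, e3, e4)"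
    by (simp add: edge_transversals_def cp3_transversals_def cplx_def complex_transversals_def forall_4 e)
  then show thesis
    using that[of e1 e2 e3 e4] i e by (simp add: Q_eq)
qed

lemma general_position: "general_position T"
  unfolding general_position_def
proof
  show "\<forall>e\<in>edge_quadruples T. card (edge_transversals e) = 2"
  proof
    fix e assume "e \<in> edge_quadruples T"
    then show "card (edge_transversals e) = 2"
      by (rule edge_quadruple_obtain) (simp add: card_facts(1))
  qed
  show "disjoint_family_on edge_transversals (edge_quadruples T)"
    unfolding disjoint_family_on_def
  proof (intro ballI impI)
    fix e e' assume e: "e \<in> edge_quadruples T" and e': "e' \<in> edge_quadruples T" and "e \<noteq> e'"
    obtain e1 e2 e3 e4 where x: "(e1, e2, e3, e4) \<in> Q" "edge_transversals e = cplx (e1, e2, e3, e4)"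
      and es: "e 1 = seg e1" "e 2 = seg e2" "e 3 = seg e3" "e 4 = seg e4"
      using e by (rule edge_quadruple_obtain)
    obtain f1 f2 f3 f4 where y: "(f1, f2, f3, f4) \<in> Q" "edge_transversals e' = cplx (f1, f2, f3, f4)"
      and fs: "e' 1 = seg f1" "e' 2 = seg f2" "e' 3 = seg f3" "e' 4 = seg f4"
      using e' by (rule edge_quadruple_obtain)
    have "(e1, e2, e3, e4) \<noteq> (f1, f2, f3, f4)"
    proof
      assume "(e1, e2, e3, e4) = (f1, f2, f3, f4)"
      then have "\<forall>i. e i = e' i"
        unfolding forall_4 using es fs by simp
      then show False
        using \<open>e \<noteq> e'\<close> by auto
    qed
    then show "edge_transversals e \<inter> edge_transversals e' = {}"
      using cplx_disjoint x y by simp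
  qed
qed

lemma common_tangents_eq: "common_tangents T = (\<Union>x\<in>Q. reals x)"
proof -
  have tangent: "tangent_to_triangle l (tri_hull t) \<longleftrightarrow> (\<exists>e\<in>set (edges t). l \<inter> seg e \<noteq> {})"
    if "nondegenerate t" for l t
    using that by (simp add: tangent_to_triangle_def triangle_edges_hull)
  have "(\<Union>x\<in>Q. reals x) = {l. \<exists>e1\<in>set (edges t1). \<exists>e2\<in>set (edges t2). \<exists>e3\<in>set (edges t3). \<exists>e4\<in>set (edges t4).
      l \<in> real_transversals e1 e2 e3 e4}"
    unfolding Q_eq reals_def by blast
  also have "\<dots> = common_tangents T"
    unfolding common_tangents_def forall_4 T_simps real_transversals_def
      tangent[OF nondegenerate(1)] tangent[OF nondegenerate(2)] tangent[OF nondegenerate(3)] tangent[OF nondegenerate(4)]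
    by blast
  finally show ?thesis ..
qed

text \<open>No tangent is counted twice: the complexification of a line in two of the real sets
  would lie in two disjoint complex ones.\<close>

lemma card_common_tangents: "card (common_tangents T) = N"
proof -
  have "reals x \<inter> reals y = {}" if "x \<in> Q" "y \<in> Q" "x \<noteq> y" for x y
  proof -
    have "cp3_supporting_line l \<in> cplx z" if "l \<in> reals z" for l z
      using that complexify_real_transversal by (cases z rule: prod_cases4) (auto simp: reals_def cplx_def)
    then show ?thesis
      using cplx_disjoint[OF that] by blast
  qed
  then have "card (common_tangents T) = (\<Sum>x\<in>Q. card (reals x))"
    unfolding common_tangents_eq using card_facts(3) by (intro card_UN_disjoint) (auto simp: Q_def)
  then show ?thesis
    using card_facts(2) by (simp add: N_eq)
qed

lemma disjoint_T: "disjoint_family T"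
  unfolding disjoint_family_on_def
  using disjoint by (simp add: forall_4 T_simps Int_commute)

lemma is_triangle_T: "is_triangle (T i)"
  unfolding T_def using nondegenerate is_triangle_hull by simp

end

section \<open>Four triangles with 62 common tangents\<close>

definition tri1 :: tri where "tri1 = ((-9, -13, -9), (14, -11, -10), (1, -9, -5))"
definition tri2 :: tri where "tri2 = ((-10, -7, 14), (-1, 14, -7), (-8, -6, 1))"
definition tri3 :: tri where "tri3 = ((-1, 14, -6), (-8, -9, 0), (-9, -13, -8))"
definition tri4 :: tri where "tri4 = ((4, -6, -9), (4, -4, -6), (-10, -12, -4))"

lemmas tri_defs = tri1_def tri2_def tri3_def tri4_def

lemma tri_generic:
  "generic_triangle tri1 tri2 tri3 tri4" "generic_triangle tri2 tri1 tri3 tri4"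
  "generic_triangle tri3 tri1 tri2 tri4" "generic_triangle tri4 tri1 tri2 tri3"
  by (simp_all add: generic_triangle_def tri_defs vol_def)

lemma tri_total_count: "total_count tri1 tri2 tri3 tri4 = Some 62"
  by (simp add: total_count_def edge_tuples_def tri_defs sum_option_def vol_def root_count_def
      surd_sgn_def side_sgns_def root_verdict_def)

interpretation example: four_triangles tri1 tri2 tri3 tri4 62
proof
  show "nondegenerate tri1" "nondegenerate tri2" "nondegenerate tri3" "nondegenerate tri4"
    by (simp_all add: tri_defs)
  \<comment> \<open>In each of the six cases the threshold is the minimum of the linear form on the
    second triangle, and the first lies strictly below it.\<close>
  show "tri_hull tri1 \<inter> tri_hull tri2 = {}"
    by (rule disjoint_if_separated[of "(0, 1, 0)" "-7"]) (simp add: separated_def tri_defs)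
  show "tri_hull tri1 \<inter> tri_hull tri3 = {}"
    by (rule disjoint_if_separated[of "(-1, 1, 1)" "-12"]) (simp add: separated_def tri_defs)
  show "tri_hull tri1 \<inter> tri_hull tri4 = {}"
    by (rule disjoint_if_separated[of "(-1, 2, 0)" "-16"]) (simp add: separated_def tri_defs)
  show "tri_hull tri2 \<inter> tri_hull tri3 = {}"
    by (rule disjoint_if_separated[of "(13, -4, 1)" "-75"]) (simp add: separated_def tri_defs)
  show "tri_hull tri2 \<inter> tri_hull tri4 = {}"
    by (rule disjoint_if_separated[of "(0, -1, -1)" "10"]) (simp add: separated_def tri_defs)
  show "tri_hull tri3 \<inter> tri_hull tri4 = {}"
    by (rule disjoint_if_separated[of "(12, -19, 8)" "76"]) (simp add: separated_def tri_defs)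
qed (rule tri_generic tri_total_count)+

theorem theorem2:
  "\<exists>T :: 4 \<Rightarrow> (real^3) set.
     (\<forall>i. is_triangle (T i)) \<and>
     disjoint_family T \<and>
     general_position T \<and>
     card (common_tangents T) = 62"
  using example.is_triangle_T example.disjoint_T example.general_position example.card_common_tangents by blast

end
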